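(* Let $\mathcal{C}$ be a translation based cipher over $V=(\mathbb{F}_2)^{mn}$ with $m\ge3$, $n\ge2$ and a strongly proper round $h$ such that, for some integer $r$, every brick of $\gamma_h$ satisfies either (A) $1<r<m$, the brick is differentially $2^r$-uniform and strongly $(r-1)$-anti-invariant; or (B) $1\le r<m$, the brick is weakly $2^r$-uniform and strongly $r$-anti-invariant (same alternative for all bricks). Suppose further that some brick $\gamma_i$ (acting on $V_i$) of $\gamma_h$ satisfies $\mathrm{Alt}(V_i)\subseteq\langle T(V_i),\gamma_iT(V_i)\gamma_i^{-1}\rangle$. Then $\Gamma_\infty(\mathcal{C})=\mathrm{Alt}(V)$.
   Context: Permutations act on the right. Let $m,n>1$ and $V=V_1\oplus\dots\oplus V_n$ with each $V_i\cong(\mathbb{F}_2)^m$. For $v$ in a vector space $X$, $\sigma_v:x\mapsto x+v$ and $T(X)=\{\sigma_v:v\in X\}$. A bricklayer transformation is a permutation $\gamma$ of $V$ with permutations ("bricks") $\gamma_i$ of $V_i$ such that $(v_1+\dots+v_n)\gamma=v_1\gamma_1+\dots+v_n\gamma_n$. A wall is a nontrivial proper subspace of $V$ that is a sum of some $V_i$; $\lambda\in\mathrm{GL}(V)$ is a proper mixing layer if no wall is $\lambda$-invariant, and strongly proper if there are no walls $W,W'$ with $W\lambda=W'$. A tb cipher $\mathcal{C}=\{\tau_k:k\in\mathcal{K}\}$ has $\tau_k=\tau_{k,1}\cdots\tau_{k,l}$ with $\tau_{k,h}=\gamma_h\lambda_h\sigma_{\phi(k,h)}$, $\gamma_h$ a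 key-independent bricklayer transformation with $0\gamma_h=0$, $\lambda_h\in\mathrm{GL}(V)$ key-independent, $\phi:\mathcal{K}\times\{1,\dots,l\}\to V$; a round $h$ is proper if $\lambda_h$ is proper and $k\mapsto\phi(k,h)$ is onto $V$ (a tb cipher has at least one proper round), strongly proper if moreover $\lambda_h$ is strongly proper. $\Gamma_h(\mathcal{C})=\langle\tau_{k,h}:k\in\mathcal{K}\rangle$, $\Gamma_\infty(\mathcal{C})=\langle\Gamma_1(\mathcal{C}),\dots,\Gamma_l(\mathcal{C})\rangle$. For $f:(\mathbb{F}_2)^m\to(\mathbb{F}_2)^m$, $\hat f_u(x)=f(x+u)+f(x)$. $f$ is differentially $\delta$-uniform if $|\{x:\hat f_u(x)=v\}|\le\delta$ for all $u\ne0$, all $v$; weakly $\delta$-uniform if $|\mathrm{Im}(\hat f_u)|>2^{m-1}/\delta$ for all $u\ne0$. For $1\le s<m$, $f$ is strongly $s$-anti-invariant if for any subspaces $U,W$ with $f(U)=W$, either $\dim U=\dim W<m-s$ or $U=W=(\mathbb{F}_2)^m$. *)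

theory Defs
  imports "HOL-Analysis.Analysis" "HOL-Library.Z2" "HOL-Combinatorics.Permutations"
begin

instance bit :: finite
proof
  have "(UNIV :: bit set) = {0, 1}" by auto
  then show "finite (UNIV :: bit set)" by (metis finite.emptyI finite_insert)
qed

(* Conventions.  A brick space V_i = (F_2)^m is the type bit^'m (m = CARD('m)),
   and V = V_1 + ... + V_n is (bit^'m)^'n (n = CARD('n)); the i-th component
   v $ i of v is its V_i-part.  Permutations act on the right: x gamma is written
   gamma x, and the right-action product  g1 g2  is the function  g2 o g1. *)

definition transl :: "'a::ab_group_add \<Rightarrow> 'a \<Rightarrow> 'a" where
  "transl v = (\<lambda>x. x + v)"

definition Tgrp :: "('a::ab_group_add \<Rightarrow> 'a) set" where
  "Tgrp = range transl"

inductive_set gen_perm :: "('a \<Rightarrow> 'a) set \<Rightarrow> ('a \<Rightarrow> 'a) set" for S where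
  gen_id: "id \<in> gen_perm S"
| gen_mult: "f \<in> S \<Longrightarrow> g \<in> gen_perm S \<Longrightarrow> g \<circ> f \<in> gen_perm S"
| gen_inv: "f \<in> S \<Longrightarrow> g \<in> gen_perm S \<Longrightarrow> g \<circ> inv f \<in> gen_perm S"

definition Alt :: "('a::finite \<Rightarrow> 'a) set" where
  "Alt = {p. p permutes UNIV \<and> evenperm p}"

definition bricklayer :: "('n::finite \<Rightarrow> 'a \<Rightarrow> 'a) \<Rightarrow> 'a^'n::finite \<Rightarrow> 'a^'n::finite" where
  "bricklayer b = (\<lambda>v. \<chi> i. b i (v $ i))"

definition bricks_ok :: "('n::finite \<Rightarrow> 'a \<Rightarrow> 'a) \<Rightarrow> bool" where
  "bricks_ok b \<longleftrightarrow> (\<forall>i. bij (b i))"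

(* GL(V) over F_2: F_2-linear (= additive) bijections *)
definition GL2 :: "('a::ab_group_add \<Rightarrow> 'a) set" where
  "GL2 = {f. bij f \<and> (\<forall>x y. f (x + y) = f x + f y)}"

definition wall_of :: "'n::finite set \<Rightarrow> (('a::zero)^'n::finite) set" where
  "wall_of I = {v. \<forall>i. i \<notin> I \<longrightarrow> v $ i = 0}"

definition walls :: "(('a::zero)^'n::finite) set set" where
  "walls = {wall_of I | I. I \<noteq> {} \<and> I \<noteq> UNIV}"

definition proper_mixing :: "(('a::ab_group_add)^'n::finite \<Rightarrow> 'a^'n::finite) \<Rightarrow> bool" where
  "proper_mixing lam \<longleftrightarrow> lam \<in> GL2 \<and> (\<forall>W\<in>walls. lam ` W \<noteq> W)"

definition strongly_proper_mixing :: "(('a::ab_group_add)^'n::finite \<Rightarrow> 'a^'n::finite) \<Rightarrow> bool" where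
  "strongly_proper_mixing lam \<longleftrightarrow> lam \<in> GL2 \<and> (\<forall>W\<in>walls. \<forall>W'\<in>walls. lam ` W \<noteq> W')"

(* tb cipher with l rounds, keys of type 'k, bricks bs h i of round h, mixing
   layers lam h, key schedule phi.  Round function tau_{k,h} = gamma_h lambda_h sigma_{phi(k,h)} *)
definition round_fun ::
  "(nat \<Rightarrow> 'n::finite \<Rightarrow> bit^'m::finite \<Rightarrow> bit^'m::finite) \<Rightarrow> (nat \<Rightarrow> (bit^'m::finite)^'n::finite \<Rightarrow> (bit^'m::finite)^'n::finite)
   \<Rightarrow> ('k \<Rightarrow> nat \<Rightarrow> (bit^'m::finite)^'n::finite) \<Rightarrow> 'k \<Rightarrow> nat \<Rightarrow> (bit^'m::finite)^'n::finite \<Rightarrow> (bit^'m::finite)^'n::finite" where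
  "round_fun bs lam phi k h = transl (phi k h) \<circ> lam h \<circ> bricklayer (bs h)"

definition proper_round ::
  "(nat \<Rightarrow> (bit^'m::finite)^'n::finite \<Rightarrow> (bit^'m::finite)^'n::finite) \<Rightarrow> ('k \<Rightarrow> nat \<Rightarrow> (bit^'m::finite)^'n::finite) \<Rightarrow> nat \<Rightarrow> bool" where
  "proper_round lam phi h \<longleftrightarrow> proper_mixing (lam h) \<and> surj (\<lambda>k. phi k h)"

definition strongly_proper_round ::
  "(nat \<Rightarrow> (bit^'m::finite)^'n::finite \<Rightarrow> (bit^'m::finite)^'n::finite) \<Rightarrow> ('k \<Rightarrow> nat \<Rightarrow> (bit^'m::finite)^'n::finite) \<Rightarrow> nat \<Rightarrow> bool" where
  "strongly_proper_round lam phi h \<longleftrightarrow> strongly_proper_mixing (lam h) \<and> surj (\<lambda>k. phi k h)"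

definition tb_cipher ::
  "nat \<Rightarrow> (nat \<Rightarrow> 'n::finite \<Rightarrow> bit^'m::finite \<Rightarrow> bit^'m::finite) \<Rightarrow> (nat \<Rightarrow> (bit^'m::finite)^'n::finite \<Rightarrow> (bit^'m::finite)^'n::finite)
   \<Rightarrow> ('k \<Rightarrow> nat \<Rightarrow> (bit^'m::finite)^'n::finite) \<Rightarrow> bool" where
  "tb_cipher l bs lam phi \<longleftrightarrow>
     (\<forall>h\<in>{1..l}. bricks_ok (bs h) \<and> bricklayer (bs h) 0 = 0 \<and> lam h \<in> GL2) \<and>
     (\<exists>h\<in>{1..l}. proper_round lam phi h)"

definition Gamma_inf ::
  "nat \<Rightarrow> (nat \<Rightarrow> 'n::finite \<Rightarrow> bit^'m::finite \<Rightarrow> bit^'m::finite) \<Rightarrow> (nat \<Rightarrow> (bit^'m::finite)^'n::finite \<Rightarrow> (bit^'m::finite)^'n::finite)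
   \<Rightarrow> ('k \<Rightarrow> nat \<Rightarrow> (bit^'m::finite)^'n::finite) \<Rightarrow> ((bit^'m::finite)^'n::finite \<Rightarrow> (bit^'m::finite)^'n::finite) set" where
  "Gamma_inf l bs lam phi = gen_perm {round_fun bs lam phi k h | k h. h \<in> {1..l}}"

definition fhat :: "('a::ab_group_add \<Rightarrow> 'a) \<Rightarrow> 'a \<Rightarrow> 'a \<Rightarrow> 'a" where
  "fhat f u = (\<lambda>x. f (x + u) + f x)"

definition diff_uniform :: "nat \<Rightarrow> (bit^'m::finite \<Rightarrow> bit^'m::finite) \<Rightarrow> bool" where
  "diff_uniform \<delta> f \<longleftrightarrow> (\<forall>u v. u \<noteq> 0 \<longrightarrow> card {x. fhat f u x = v} \<le> \<delta>)"

definition weakly_uniform :: "nat \<Rightarrow> (bit^'m::finite \<Rightarrow> bit^'m::finite) \<Rightarrow> bool" where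
  "weakly_uniform \<delta> f \<longleftrightarrow>
     (\<forall>u. u \<noteq> 0 \<longrightarrow> real (card (range (fhat f u))) > 2 ^ (CARD('m) - 1) / real \<delta>)"

definition strongly_anti_invariant :: "nat \<Rightarrow> (bit^'m::finite \<Rightarrow> bit^'m::finite) \<Rightarrow> bool" where
  "strongly_anti_invariant s f \<longleftrightarrow> 1 \<le> s \<and> s < CARD('m) \<and>
     (\<forall>U W. vec.subspace U \<longrightarrow> vec.subspace W \<longrightarrow> f ` U = W \<longrightarrow>
        (vec.dim U = vec.dim W \<and> vec.dim U < CARD('m) - s) \<or> (U = UNIV \<and> W = UNIV))"

end

theory Submission
  imports Defs
begin

text \<open>
  Let \<open>G = \<Gamma>\<^sub>\<infinity>\<close>, \<open>q = 2\<^sup>m\<close> and \<open>N = |V|\<close>.  The strongly proper round gives \<open>T(V) \<subseteq> G\<close> and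
  \<open>\<rho> = \<gamma>\<^sub>h\<lambda>\<^sub>h \<in> G\<close>, and the hypothesis on the \<open>i\<close>-th brick gives the group \<open>K = Alt(V\<^sub>i)\<close> acting on the
  \<open>i\<close>-th coordinate alone.  All generators are even, because they are products of bricklayers and
  linear maps in dimension at least three.

  A bricklayer with good bricks that maps the cosets of a subspace \<open>U\<close> to the cosets of a subspace
  forces \<open>U\<close> to be a wall or trivial; so \<open>G\<close> is primitive.  To see that \<open>G\<close> is two-transitive, count for
  two points the points that distinguish them, i.e. that lie with them in different orbitals.  The
  symmetry under \<open>K\<close> and primitivity show that this number is minimal exactly on the orbital of the
  points of \<open>V\<^sub>i\<close>, and that the neighbours of \<open>0\<close> in this orbital graph fall into subspaces
  (\<open>lines\<close>) whose cosets are permuted by \<open>G\<close>.  Proper lines would be walls permuted by \<open>\<lambda>\<^sub>h\<close>, so there is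
  just one line.

  Two-transitivity is raised to four-transitivity by another double count: an invariant
  ternary relation can change between two points of a \<open>K\<close>-orbit only on \<open>2N/q \<le> N/4\<close> points.  Finally \<open>K\<close>
  contains an element moving \<open>3N/q \<le> 3N/8\<close> points, and an averaging argument in the style of
  Bochert produces elements with fewer and fewer moved points, down to a three-cycle.
\<close>

section \<open>Higher transitivity\<close>

definition perm_group :: "('a \<Rightarrow> 'a) set \<Rightarrow> bool" where
  "perm_group G \<longleftrightarrow> id \<in> G \<and> (\<forall>f\<in>G. bij f \<and> inv f \<in> G) \<and> (\<forall>f\<in>G. \<forall>g\<in>G. f \<circ> g \<in> G)"

lemma perm_groupD:
  assumes "perm_group G"
  shows "id \<in> G" "f \<in> G \<Longrightarrow> bij f" "f \<in> G \<Longrightarrow> inv f \<in> G" "f \<in> G \<Longrightarrow> g \<in> G \<Longrightarrow> f \<circ> g \<in> G"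
  using assms by (auto simp: perm_group_def)

lemma perm_group_stabilizer:
  assumes "perm_group G"
  shows "perm_group {g \<in> G. g p = p}"
proof -
  have "inv f p = p" if "f \<in> G" "f p = p" for f
    using perm_groupD(2)[OF assms that(1)] that(2) by (simp add: bij_is_inj inv_f_eq)
  then show ?thesis using assms by (auto simp: perm_group_def)
qed

text \<open>Double counting through a projection with constant fibres; the counts of triples,
  quadruples and group elements below rest on it.\<close>

lemma card_eq_mult_fibre_card:
  assumes "finite A" "finite P" "f ` A \<subseteq> P" "\<And>p. p \<in> P \<Longrightarrow> card {x \<in> A. f x = p} = b"
  shows "card A = card P * b"
proof -
  have "card A = (\<Sum>x\<in>A. 1)" by simp
  also have "\<dots> = (\<Sum>p\<in>P. \<Sum>x | x \<in> A \<and> f x = p. 1)"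
    by (rule sum.group[OF assms(1,2,3), symmetric])
  also have "\<dots> = (\<Sum>p\<in>P. b)" using assms(4) by (intro sum.cong) auto
  finally show ?thesis by simp
qed

text \<open>
  The relation is counted in two ways through the number of pairs that distinguish two points
  \<open>u, v\<close>: two-transitivity makes this number the same for all \<open>u, v\<close>, and the hypothesis on \<open>M\<close>
  bounds it for one choice.
\<close>

lemma invariant_ternary_relation_large:
  fixes R :: "'a::finite set"
  assumes H: "perm_group H"
    and T_inv: "\<And>h r u w. h \<in> H \<Longrightarrow> T r u w \<Longrightarrow> T (h r) (h u) (h w)"
    and T_dist: "\<And>r u w. T r u w \<Longrightarrow> r \<in> R \<and> u \<in> R \<and> w \<in> R \<and> r \<noteq> u \<and> r \<noteq> w \<and> u \<noteq> w"
    and trans2: "\<And>x y x' y'. \<lbrakk>x \<in> R; y \<in> R; x \<noteq> y; x' \<in> R; y' \<in> R; x' \<noteq> y'\<rbrakk> \<Longrightarrow> \<exists>h\<in>H. h x = x' \<and> h y = y'"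
    and M: "M \<subseteq> R" "u \<in> M" "v \<in> M" "u \<noteq> v" "4 * card M \<le> card R + 5"
    and moves: "\<And>r w. r \<in> R - M \<Longrightarrow> w \<in> R - M \<Longrightarrow> \<exists>h\<in>H. h r = r \<and> h w = w \<and> h u = v"
    and T0: "T r0 u0 w0"
  shows "card R < 2 * card {w. T r0 u0 w} + 2"
proof -
  define n where "n = card R"
  define P where "P = {(x, y). x \<in> R \<and> y \<in> R \<and> x \<noteq> y}"
  define TT where "TT = {(r, u, w). T r u w}"
  define b where "b = card {w. T r0 u0 w}"
  have bijH: "bij h" "bij (inv h)" "inv h \<in> H" if "h \<in> H" for h
    using perm_groupD(2,3)[OF H] that by auto
  have T_iff: "T (h r) (h u) (h w) \<longleftrightarrow> T r u w" if "h \<in> H" for h r u w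
    using T_inv[OF that, of r u w] T_inv[OF bijH(3)[OF that], of "h r" "h u" "h w"] bijH(1)[OF that]
    by (auto simp: bij_is_inj)
  have surj_ex: "\<exists>y. h y = x" if "h \<in> H" for h x
    using bijH(1)[OF that] by (metis bij_pointE)
  have inj_eq: "h x = h y \<longleftrightarrow> x = y" if "h \<in> H" for h x y
    using bijH(1)[OF that] by (simp add: bij_is_inj inj_eq)
  have r0: "(r0, u0) \<in> P" using T_dist[OF T0] by (auto simp: P_def)
  have Ppos: "card P > 0" using r0 by (auto simp: card_gt_0_iff)
  \<comment> \<open>By two-transitivity the number of completions depends only on which of the three
    positions is left free.\<close>
  have row: "card {w. T r u w} = card {w. T r' u' w}" and mid: "card {w. T r w u} = card {w. T r' w u'}"
    and col: "card {w. T w r u} = card {w. T w r' u'}"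
    if "(r, u) \<in> P" "(r', u') \<in> P" for r u r' u'
  proof -
    obtain h where h: "h \<in> H" "h r = r'" "h u = u'"
      using trans2[of r u r' u'] \<open>(r, u) \<in> P\<close> \<open>(r', u') \<in> P\<close> by (auto simp: P_def)
    have inj: "inj_on h A" for A using bijH(1)[OF h(1)] by (meson bij_is_inj inj_on_subset subset_UNIV)
    have "h ` {w. T r u w} = {w. T r' u' w}" "h ` {w. T r w u} = {w. T r' w u'}" "h ` {w. T w r u} = {w. T w r' u'}"
      unfolding h(2,3)[symmetric] using T_iff[OF h(1)] surj_ex[OF h(1)] by (auto simp: image_iff) metis+
    then show "card {w. T r u w} = card {w. T r' u' w}" "card {w. T r w u} = card {w. T r' w u'}"
      "card {w. T w r u} = card {w. T w r' u'}"
      using card_image[OF inj] by metis+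
  qed
  have rowb: "card {w. T r u w} = b" if "(r, u) \<in> P" for r u using row[OF that r0] by (simp add: b_def)
  define d where "d = card {w. T r0 w u0}"
  define c where "c = card {w. T w r0 u0}"
  have TTb: "card TT = card P * b"
  proof (rule card_eq_mult_fibre_card[where f = "\<lambda>(r, u, w). (r, u)"])
    fix p assume "p \<in> P"
    then obtain r u where p: "p = (r, u)" "(r, u) \<in> P" by (cases p) auto
    have "{x \<in> TT. (case x of (r, u, w) \<Rightarrow> (r, u)) = p} = (\<lambda>w. (r, u, w)) ` {w. T r u w}"
      by (auto simp: p TT_def)
    then show "card {x \<in> TT. (case x of (r, u, w) \<Rightarrow> (r, u)) = p} = b"
      using rowb[OF p(2)] by (simp add: card_image inj_on_def)
  qed (use T_dist in \<open>auto simp: TT_def P_def\<close>)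
  have TTd: "card TT = card P * d"
  proof (rule card_eq_mult_fibre_card[where f = "\<lambda>(r, u, w). (r, w)"])
    fix p assume "p \<in> P"
    then obtain r w where p: "p = (r, w)" "(r, w) \<in> P" by (cases p) auto
    have "{x \<in> TT. (case x of (r, u, w) \<Rightarrow> (r, w)) = p} = (\<lambda>u. (r, u, w)) ` {u. T r u w}"
      by (auto simp: p TT_def)
    then show "card {x \<in> TT. (case x of (r, u, w) \<Rightarrow> (r, w)) = p} = d"
      using mid[OF p(2) r0] by (simp add: card_image inj_on_def d_def)
  qed (use T_dist in \<open>auto simp: TT_def P_def\<close>)
  have TTc: "card TT = card P * c"
  proof (rule card_eq_mult_fibre_card[where f = "\<lambda>(r, u, w). (u, w)"])
    fix p assume "p \<in> P"
    then obtain u w where p: "p = (u, w)" "(u, w) \<in> P" by (cases p) auto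
    have "{x \<in> TT. (case x of (r, u, w) \<Rightarrow> (u, w)) = p} = (\<lambda>r. (r, u, w)) ` {r. T r u w}"
      by (auto simp: p TT_def)
    then show "card {x \<in> TT. (case x of (r, u, w) \<Rightarrow> (u, w)) = p} = c"
      using col[OF p(2) r0] by (simp add: card_image inj_on_def c_def)
  qed (use T_dist in \<open>auto simp: TT_def P_def\<close>)
  \<comment> \<open>The three projections of \<open>TT\<close> onto pairs have fibres of sizes
    \<open>b\<close>, \<open>d\<close>, \<open>c\<close> over the same set \<open>P\<close>, so
    these numbers agree.\<close>
  have db: "d = b" "c = b" using TTb TTd TTc Ppos by auto
  have midb: "card {u. T r u w} = b" and colb: "card {x. T x r w} = b" if "(r, w) \<in> P" for r w
    using mid[OF that r0] col[OF that r0] db by (auto simp: d_def c_def)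
  \<comment> \<open>\<open>r = v\<close> is left out because \<open>T v v w\<close> fails for the
    trivial reason of a repeated entry; \<open>w = v\<close> stays in.\<close>
  define dist where "dist u v = {(r, w). T r u w \<and> r \<noteq> v \<and> \<not> T r v w}" for u v
  have dist_const: "card (dist x y) = card (dist u v)" if "(x, y) \<in> P" for x y
  proof -
    have "u \<in> R" "v \<in> R" using M by auto
    then obtain h where h: "h \<in> H" "h x = u" "h y = v"
      using trans2[of x y u v] \<open>(x, y) \<in> P\<close> \<open>u \<noteq> v\<close> by (auto simp: P_def)
    have "(\<lambda>(r, w). (h r, h w)) ` dist x y = dist u v"
    proof (intro equalityI subsetI)
      fix z assume "z \<in> (\<lambda>(r, w). (h r, h w)) ` dist x y"
      then show "z \<in> dist u v" using T_iff[OF h(1)] inj_eq[OF h(1)] h by (auto simp: dist_def)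
    next
      fix z assume z: "z \<in> dist u v"
      obtain r w where rw: "z = (h r, h w)" using surj_ex[OF h(1)] by (metis surj_pair)
      show "z \<in> (\<lambda>(r, w). (h r, h w)) ` dist x y"
        using z T_iff[OF h(1)] inj_eq[OF h(1)] h(2,3) unfolding rw
        by (intro image_eqI[of _ _ "(r, w)"]) (auto simp: dist_def)
    qed
    moreover have "inj_on (\<lambda>(r, w). (h r, h w)) (dist x y)"
      using inj_eq[OF h(1)] by (auto simp: inj_on_def)
    ultimately show ?thesis by (metis card_image)
  qed
  \<comment> \<open>Counted twice: over \<open>(x, y)\<close> the fibre is a copy of
    \<open>dist x y\<close>; over a triple \<open>(r, x, w)\<close> of the relation it consists of
    the \<open>y\<close> that leave the relation.\<close>
  define QQ where "QQ = {(x, y, r, w). T r x w \<and> y \<in> R \<and> y \<noteq> x \<and> y \<noteq> r \<and> \<not> T r y w}"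
  have QQ1: "card QQ = card P * card (dist u v)"
  proof (rule card_eq_mult_fibre_card[where f = "\<lambda>(x, y, r, w). (x, y)"])
    fix p assume "p \<in> P"
    then obtain x y where p: "p = (x, y)" "(x, y) \<in> P" by (cases p) auto
    have "{q \<in> QQ. (case q of (x, y, r, w) \<Rightarrow> (x, y)) = p} = (\<lambda>(r, w). (x, y, r, w)) ` dist x y"
      using p(2) by (auto simp: p(1) QQ_def dist_def P_def image_iff)
    then show "card {q \<in> QQ. (case q of (x, y, r, w) \<Rightarrow> (x, y)) = p} = card (dist u v)"
      using dist_const[OF p(2)] by (simp add: card_image inj_on_def split_def)
  qed (use T_dist in \<open>auto simp: QQ_def P_def\<close>)
  have QQ2: "card QQ = card TT * (n - 1 - b)"
  proof (rule card_eq_mult_fibre_card[where f = "\<lambda>(x, y, r, w). (r, x, w)"])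
    fix p assume "p \<in> TT"
    then obtain r x w where p: "p = (r, x, w)" "T r x w" by (cases p) (auto simp: TT_def)
    have d: "r \<in> R" "x \<in> R" "w \<in> R" "r \<noteq> x" "r \<noteq> w" "x \<noteq> w" using T_dist[OF p(2)] by auto
    have sub: "{y. T r y w} - {x} \<subseteq> R - {x, r}" using T_dist by auto
    have "{q \<in> QQ. (case q of (x, y, r, w) \<Rightarrow> (r, x, w)) = p} = (\<lambda>y. (x, y, r, w)) ` ((R - {x, r}) - ({y. T r y w} - {x}))"
      using p by (auto simp: QQ_def image_iff)
    then have "card {q \<in> QQ. (case q of (x, y, r, w) \<Rightarrow> (r, x, w)) = p} = card ((R - {x, r}) - ({y. T r y w} - {x}))"
      by (simp add: card_image inj_on_def)
    also have "\<dots> = card (R - {x, r}) - card ({y. T r y w} - {x})"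
      by (rule card_Diff_subset[OF _ sub]) simp
    also have "card (R - {x, r}) = n - 2" using d by (simp add: card_Diff_subset n_def)
    also have "card ({y. T r y w} - {x}) = b - 1" using p(2) midb[of r w] d by (simp add: P_def)
    \<comment> \<open>Truncated subtraction: the identity needs \<open>b > 0\<close>, which the
      triple \<open>(r, x, w)\<close> provides.\<close>
    also have "n - 2 - (b - 1) = n - 1 - b"
    proof -
      have "x \<in> {y. T r y w}" using p by simp
      then have "card {y. T r y w} \<noteq> 0" by (metis card_eq_0_iff empty_iff finite)
      then have "b > 0" using midb[of r w] d by (simp add: P_def)
      then show ?thesis by auto
    qed
    finally show "card {q \<in> QQ. (case q of (x, y, r, w) \<Rightarrow> (r, x, w)) = p} = n - 1 - b" .
  qed (use T_dist in \<open>auto simp: QQ_def TT_def\<close>)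
  have dist_eq: "card (dist u v) = b * (n - 1 - b)"
    using QQ1 QQ2 TTb Ppos by auto
  \<comment> \<open>If \<open>r\<close> and \<open>w\<close> both lie outside \<open>M\<close>,
    \<open>moves\<close> carries \<open>u\<close> to \<open>v\<close> while fixing them, so they
    distinguish nothing. Distinctness removes \<open>u\<close>, \<open>v\<close> from the choices
    for \<open>r\<close> and \<open>u\<close> from those for \<open>w\<close>; the bound becomes
    \<open>2 * card M - 3\<close> rows, which explains the 5 in the hypothesis on
    \<open>M\<close>.\<close>
  have "dist u v \<subseteq> (\<Union>r\<in>M - {u, v}. {r} \<times> {w. T r u w}) \<union> (\<Union>w\<in>M - {u}. {r. T r u w} \<times> {w})"
  proof clarify
    fix r w assume rw: "(r, w) \<in> dist u v" "(r, w) \<notin> (\<Union>w\<in>M - {u}. {r. T r u w} \<times> {w})"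
    then have T: "T r u w" "r \<noteq> v" "\<not> T r v w" by (auto simp: dist_def)
    have wM: "w \<notin> M" using rw T T_dist[OF T(1)] by auto
    have "r \<in> M"
    proof (rule ccontr)
      assume "r \<notin> M"
      then obtain h where "h \<in> H" "h r = r" "h w = w" "h u = v"
        using moves[of r w] T_dist[OF T(1)] wM by auto
      then show False using T_inv[OF _ T(1)] T(3) by metis
    qed
    then show "(r, w) \<in> (\<Union>r\<in>M - {u, v}. {r} \<times> {w. T r u w})" using T T_dist[OF T(1)] by auto
  qed
  then have "card (dist u v) \<le> card ((\<Union>r\<in>M - {u, v}. {r} \<times> {w. T r u w}) \<union> (\<Union>w\<in>M - {u}. {r. T r u w} \<times> {w}))"
    by (intro card_mono) auto
  also have "\<dots> \<le> card (\<Union>r\<in>M - {u, v}. {r} \<times> {w. T r u w}) + card (\<Union>w\<in>M - {u}. {r. T r u w} \<times> {w})"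
    by (rule card_Un_le)
  also have "\<dots> \<le> (\<Sum>r\<in>M - {u, v}. card ({r} \<times> {w. T r u w})) + (\<Sum>w\<in>M - {u}. card ({r. T r u w} \<times> {w}))"
    by (intro add_mono card_UN_le) auto
  also have "(\<Sum>r\<in>M - {u, v}. card ({r} \<times> {w. T r u w})) = (\<Sum>r\<in>M - {u, v}. b)"
    using rowb[of _ u] M by (intro sum.cong) (auto simp: P_def card_cartesian_product)
  also have "(\<Sum>w\<in>M - {u}. card ({r. T r u w} \<times> {w})) = (\<Sum>w\<in>M - {u}. b)"
    using colb[of u] M by (intro sum.cong) (auto simp: P_def card_cartesian_product)
  also have "(\<Sum>r\<in>M - {u, v}. b) + (\<Sum>w\<in>M - {u}. b) = b * ((card M - 2) + (card M - 1))"
    using M by (simp add: card_Diff_subset algebra_simps)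
  finally have "b * (n - 1 - b) \<le> b * ((card M - 2) + (card M - 1))" by (simp add: dist_eq)
  moreover have "b > 0" using T0 by (auto simp: b_def card_gt_0_iff)
  ultimately have "n - 1 - b \<le> (card M - 2) + (card M - 1)" by simp
  moreover have "card {u, v} \<le> card M" using M by (intro card_mono) auto
  then have "card M \<ge> 2" using M by simp
  ultimately show ?thesis using M(5) by (fold n_def b_def) auto
qed

text \<open>Every orbit on triples of distinct points is an invariant relation and so contains, over
  a fixed pair, at least (|R| - 1)/2 third points. Two different orbits are disjoint and would need
  |R| - 1 of the |R| - 2 points available.\<close>

lemma transitive3_of_transitive2:
  fixes R :: "'a::finite set"
  assumes H: "perm_group H"
    and R_inv: "\<And>h x. h \<in> H \<Longrightarrow> x \<in> R \<Longrightarrow> h x \<in> R"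
    and trans2: "\<And>x y x' y'. \<lbrakk>x \<in> R; y \<in> R; x \<noteq> y; x' \<in> R; y' \<in> R; x' \<noteq> y'\<rbrakk> \<Longrightarrow> \<exists>h\<in>H. h x = x' \<and> h y = y'"
    and M: "M \<subseteq> R" "u \<in> M" "v \<in> M" "u \<noteq> v" "4 * card M \<le> card R + 5"
    and moves: "\<And>r w. r \<in> R - M \<Longrightarrow> w \<in> R - M \<Longrightarrow> \<exists>h\<in>H. h r = r \<and> h w = w \<and> h u = v"
    and x: "x \<in> R" "y \<in> R" "z \<in> R" "x \<noteq> y" "x \<noteq> z" "y \<noteq> z"
    and x': "x' \<in> R" "y' \<in> R" "z' \<in> R" "x' \<noteq> y'" "x' \<noteq> z'" "y' \<noteq> z'"
  shows "\<exists>h\<in>H. h x = x' \<and> h y = y' \<and> h z = z'"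
proof (rule ccontr)
  assume no: "\<not> ?thesis"
  define T where "T a b c r u w \<longleftrightarrow> (\<exists>h\<in>H. h a = r \<and> h b = u \<and> h c = w)" for a b c r u w
  have T_inv: "T a b c (h r) (h u) (h w)" if "h \<in> H" "T a b c r u w" for a b c h r u w
    using that perm_groupD(4)[OF H] unfolding T_def by (metis comp_apply)
  have T_dist: "r \<in> R \<and> u \<in> R \<and> w \<in> R \<and> r \<noteq> u \<and> r \<noteq> w \<and> u \<noteq> w"
    if "T a b c r u w" "a \<in> R" "b \<in> R" "c \<in> R" "a \<noteq> b" "a \<noteq> c" "b \<noteq> c" for a b c r u w
    using that R_inv perm_groupD(2)[OF H] unfolding T_def by (metis bij_pointE)
  have T_refl: "T a b c a b c" for a b c using perm_groupD(1)[OF H] by (auto simp: T_def intro!: bexI[of _ id])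
  \<comment> \<open>This moves the first orbit over the pair \<open>x', y'\<close>, where it can be
    compared with the second one.\<close>
  obtain h where h: "h \<in> H" "h x = x'" "h y = y'" using trans2 x x' by blast
  have T1: "T x y z x' y' (h z)" using h by (auto simp: T_def)
  have big: "card R < 2 * card {w. T a b c r0 u0 w} + 2"
    if "T a b c r0 u0 w0" "a \<in> R" "b \<in> R" "c \<in> R" "a \<noteq> b" "a \<noteq> c" "b \<noteq> c" for a b c r0 u0 w0
  proof (rule invariant_ternary_relation_large[where T = "T a b c" and H = H and M = M and u = u and v = v])
    show "\<And>r w. r \<in> R - M \<Longrightarrow> w \<in> R - M \<Longrightarrow> \<exists>h\<in>H. h r = r \<and> h w = w \<and> h u = v" by (rule moves)
    show "\<And>r u w. T a b c r u w \<Longrightarrow> r \<in> R \<and> u \<in> R \<and> w \<in> R \<and> r \<noteq> u \<and> r \<noteq> w \<and> u \<noteq> w"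
      using T_dist that by blast
  qed (fact H T_inv trans2 M that)+
  have 1: "card R < 2 * card {w. T x y z x' y' w} + 2" using big[OF T1] x by blast
  have 2: "card R < 2 * card {w. T x' y' z' x' y' w} + 2" using big[OF T_refl] x' by blast
  have disj: "{w. T x y z x' y' w} \<inter> {w. T x' y' z' x' y' w} = {}"
  proof -
    { fix w assume "T x y z x' y' w" "T x' y' z' x' y' w"
      then obtain f g where f: "f \<in> H" "f x = x'" "f y = y'" "f z = w"
        and g: "g \<in> H" "g x' = x'" "g y' = y'" "g z' = w" by (auto simp: T_def)
      have "inv g w = z'" "inv g x' = x'" "inv g y' = y'"
        using g perm_groupD(2)[OF H g(1)] by (metis bij_is_inj inv_f_f)+
      then have "(inv g \<circ> f) x = x' \<and> (inv g \<circ> f) y = y' \<and> (inv g \<circ> f) z = z'" using f by simp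
      moreover have "inv g \<circ> f \<in> H" using f g perm_groupD(3,4)[OF H] by blast
      ultimately have False using no by blast }
    then show ?thesis by blast
  qed
  have "{w. T x y z x' y' w} \<union> {w. T x' y' z' x' y' w} \<subseteq> R - {x', y'}"
    using T_dist[of x y z] T_dist[of x' y' z'] x x' by blast
  then have "card ({w. T x y z x' y' w} \<union> {w. T x' y' z' x' y' w}) \<le> card (R - {x', y'})"
    by (intro card_mono) auto
  also have "card ({w. T x y z x' y' w} \<union> {w. T x' y' z' x' y' w}) = card {w. T x y z x' y' w} + card {w. T x' y' z' x' y' w}"
    using disj by (intro card_Un_disjoint) auto
  also have "card (R - {x', y'}) = card R - 2" using x' by (simp add: card_Diff_subset)
  finally have "card {w. T x y z x' y' w} + card {w. T x' y' z' x' y' w} \<le> card R - 2" .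
  moreover have "card {x', y'} \<le> card R" using x' by (intro card_mono) auto
  then have "2 \<le> card R" using x' by simp
  ultimately show False using 1 2 by linarith
qed

section \<open>Minimal degree\<close>

text \<open>Written with two transpositions so that evenness is immediate; it is the cycle
  \<open>a\<close>, \<open>b\<close>, \<open>c\<close> only for distinct arguments.\<close>

definition cyc3 :: "'a \<Rightarrow> 'a \<Rightarrow> 'a \<Rightarrow> 'a \<Rightarrow> 'a" where
  "cyc3 a b c = Transposition.transpose a b \<circ> Transposition.transpose b c"

lemma cyc3_apply:
  assumes "a \<noteq> b" "a \<noteq> c" "b \<noteq> c"
  shows "cyc3 a b c x = (if x = a then b else if x = b then c else if x = c then a else x)"
  using assms by (auto simp: cyc3_def Transposition.transpose_def)

lemma cyc3_bij: "bij (cyc3 a b c)"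
  by (simp add: cyc3_def bij_comp)

lemma permutation_of_bij: "bij (f :: 'a::finite \<Rightarrow> 'a) \<Longrightarrow> permutation f"
  by (simp add: permutation)

lemma cyc3_even:
  assumes "a \<noteq> b" "b \<noteq> c"
  shows "evenperm (cyc3 a b c)"
  using assms by (simp add: cyc3_def evenperm_comp permutation_swap_id evenperm_swap)

lemma cyc3_in_Alt: "a \<noteq> b \<Longrightarrow> b \<noteq> c \<Longrightarrow> cyc3 a b (c :: 'a::finite) \<in> Alt"
  by (auto simp: Alt_def cyc3_even) (simp add: cyc3_def permutes_compose permutes_swap_id)

lemma cyc3_conj:
  assumes "bij g" "a \<noteq> b" "a \<noteq> c" "b \<noteq> c"
  shows "g \<circ> cyc3 a b c \<circ> inv g = cyc3 (g a) (g b) (g c)"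
proof
  fix x
  obtain y where y: "x = g y" using assms(1) by (metis bij_pointE)
  have "inj g" using assms(1) by (rule bij_is_inj)
  then show "(g \<circ> cyc3 a b c \<circ> inv g) x = cyc3 (g a) (g b) (g c) x"
    using assms(2-4) by (simp add: y cyc3_apply inj_eq)
qed

text \<open>Induction on the number of moved points. If \<open>p\<close> moves \<open>a\<close> to
  \<open>b\<close> and also moves a third point \<open>c\<close>, the cycle sending \<open>b\<close>
  back to \<open>a\<close> makes \<open>a\<close> fixed and moves no point that \<open>p\<close>
  fixes. If there is no such \<open>c\<close>, \<open>p\<close> is a transposition and hence
  odd.\<close>

lemma Alt_subset_if_cyc3:
  fixes G :: "('a::finite \<Rightarrow> 'a) set"
  assumes G: "perm_group G"
    and cyc: "\<And>a b c. a \<noteq> b \<Longrightarrow> a \<noteq> c \<Longrightarrow> b \<noteq> c \<Longrightarrow> cyc3 a b c \<in> G"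
  shows "Alt \<subseteq> G"
proof
  fix p :: "'a \<Rightarrow> 'a" assume "p \<in> Alt"
  then have "bij p" "evenperm p" by (auto simp: Alt_def permutes_bij)
  then show "p \<in> G"
  proof (induction "card {x. p x \<noteq> x}" arbitrary: p rule: less_induct)
    case less
    have inj: "p x = p y \<longleftrightarrow> x = y" for x y using less.prems(1) by (simp add: bij_is_inj inj_eq)
    show ?case
    proof (cases "p = id")
      case True then show ?thesis using perm_groupD(1)[OF G] by simp
    next
      case False
      then obtain a where a: "p a \<noteq> a" by (auto simp: fun_eq_iff)
      define b where "b = p a"
      have pb: "p b \<noteq> b" using a inj by (auto simp: b_def)
      show ?thesis
      proof (cases "\<exists>c. p c \<noteq> c \<and> c \<noteq> a \<and> c \<noteq> b")
        case True
        then obtain c where c: "p c \<noteq> c" "c \<noteq> a" "c \<noteq> b" by blast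
        define t where "t = cyc3 b a c"
        have t: "t x = (if x = b then a else if x = a then c else if x = c then b else x)" for x
          using a c by (auto simp: t_def b_def cyc3_apply)
        have tG: "t \<in> G" using cyc a c by (auto simp: t_def b_def)
        have tb: "bij t" by (simp add: t_def cyc3_bij)
        have "{x. (t \<circ> p) x \<noteq> x} \<subset> {x. p x \<noteq> x}"
        proof
          show "{x. (t \<circ> p) x \<noteq> x} \<subseteq> {x. p x \<noteq> x}" using a pb c by (auto simp: t)
          have "(t \<circ> p) a = a" using b_def by (simp add: t)
          then show "{x. (t \<circ> p) x \<noteq> x} \<noteq> {x. p x \<noteq> x}" using a by blast
        qed
        then have "card {x. (t \<circ> p) x \<noteq> x} < card {x. p x \<noteq> x}" by (intro psubset_card_mono) auto
        moreover have "evenperm (t \<circ> p)"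
          using less.prems tb a c by (simp add: evenperm_comp permutation_of_bij) (simp add: t_def b_def cyc3_even)
        ultimately have "t \<circ> p \<in> G" using less.hyps[of "t \<circ> p"] less.prems(1) tb by (simp add: bij_comp)
        then have "inv t \<circ> (t \<circ> p) \<in> G" using perm_groupD(3,4)[OF G] tG by blast
        also have "inv t \<circ> (t \<circ> p) = p" using tb by (simp add: fun_eq_iff bij_is_inj)
        finally show ?thesis .
      next
        case False
        have "p b = a"
        proof (rule ccontr)
          assume "p b \<noteq> a"
          moreover have "p (p b) \<noteq> p b" using pb inj by blast
          ultimately show False using False pb by blast
        qed
        then have "p = Transposition.transpose a b" using False b_def by (auto simp: fun_eq_iff Transposition.transpose_def)
        then show ?thesis using less.prems(2) a b_def evenperm_swap[of a b] by metis
      qed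
    qed
  qed
qed

lemma card_Compl_finite: "card (- A) = CARD('a) - card A" for A :: "'a::finite set"
  by (simp add: Compl_eq_Diff_UNIV card_Diff_subset)

lemma sum_remove2:
  fixes f :: "'a \<Rightarrow> 'b::comm_monoid_add"
  assumes "finite A" "a \<in> A" "b \<in> A" "a \<noteq> b"
  shows "sum f A = f a + (f b + sum f (A - {a} - {b}))"
proof -
  have "sum f A = f a + sum f (A - {a})" by (rule sum.remove) (use assms in auto)
  also have "sum f (A - {a}) = f b + sum f (A - {a} - {b})" by (rule sum.remove) (use assms in auto)
  finally show ?thesis .
qed

lemma sum_card_swap:
  assumes "finite A" "finite B"
  shows "(\<Sum>a\<in>A. card {b \<in> B. P a b}) = (\<Sum>b\<in>B. card {a \<in> A. P a b})"
proof -
  have "(\<Sum>a\<in>A. card {b \<in> B. P a b}) = (\<Sum>a\<in>A. \<Sum>b\<in>B. if P a b then 1 else 0)"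
    using assms by (intro sum.cong refl) (simp add: sum.If_cases Int_def)
  also have "\<dots> = (\<Sum>b\<in>B. \<Sum>a\<in>A. if P a b then 1 else 0)" by (rule sum.swap)
  also have "\<dots> = (\<Sum>b\<in>B. card {a \<in> A. P a b})"
    using assms by (intro sum.cong refl) (simp add: sum.If_cases Int_def)
  finally show ?thesis .
qed

text \<open>The two sides differ by \<open>F N + (m - 2) * (m - 1)\<close>, and \<open>F\<close> is
  a quadratic with leading coefficient \<open>m - 3 > 0\<close>. Once its slope is nonnegative it
  suffices to evaluate it at a lower bound for \<open>N\<close>: 64 when \<open>m \<le> 24\<close>,
  and 8m/3 otherwise.\<close>

lemma minimal_degree_inequality:
  fixes m N :: real
  assumes m: "4 \<le> m" "8 * m \<le> 3 * N" and N: "64 \<le> N"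
  shows "3 * ((N - 2) * (N - 3)) + (m - 1) * (m - 2) * (N - 3) + (m - 1) * (N - 3)
     + (m - 2) * (m - 2) * (N - m) + (m - 2) * (m - 1) * (N - m - 1) < m * ((N - 2) * (N - 3))"
proof -
  define F where "F n = (m - 3) * n\<^sup>2 - (3 * m\<^sup>2 - 4 * m - 8) * n + (2 * m^3 - 4 * m\<^sup>2 + 6 * m - 15)" for n :: real
  have mono: "F n \<le> F N" if "n \<le> N" "3 * m\<^sup>2 - 4 * m - 8 \<le> (m - 3) * (2 * n)" for n
  proof -
    have "(m - 3) * (2 * n) \<le> (m - 3) * (N + n)" using m that by (intro mult_left_mono) auto
    then have "0 \<le> (N - n) * ((m - 3) * (N + n) - (3 * m\<^sup>2 - 4 * m - 8))"
      using that by (intro mult_nonneg_nonneg) auto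
    also have "\<dots> = F N - F n" by (simp add: F_def algebra_simps power2_eq_square)
    finally show ?thesis by simp
  qed
  have "F N > 0"
  proof (cases "m \<le> 24")
    case True
    have 1: "0 \<le> (m - 4) * (24 - m)" using True m by simp
    have "3 * m\<^sup>2 - 4 * m - 8 \<le> (m - 3) * (2 * 64)"
      using 1 True m by (simp add: algebra_simps power2_eq_square)
    then have "F 64 \<le> F N" using N by (intro mono) auto
    moreover define X where "X = (m - 4) * (24 - m) * (2 * (24 - m) + 92)"
    moreover have "F 64 = X + (m - 4) * 246 + 2633"
      by (simp add: F_def X_def algebra_simps power2_eq_square power3_eq_cube)
    moreover have "0 \<le> X" unfolding X_def using True m by (intro mult_nonneg_nonneg) auto
    ultimately show ?thesis using m(1) by (smt (verit))
  next
    case False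
    have mm: "24 * m \<le> m * m" using False by (intro mult_right_mono) auto
    have "3 * m\<^sup>2 - 4 * m - 8 \<le> (m - 3) * (2 * (8 / 3 * m))"
    proof -
      have "(m - 3) * (2 * (8 / 3 * m)) - (3 * m\<^sup>2 - 4 * m - 8) = 7 / 3 * (m * m) - 12 * m + 8"
        by (simp add: field_simps power2_eq_square)
      then show ?thesis using mm False by linarith
    qed
    then have "F (8 / 3 * m) \<le> F N" using m by (intro mono) auto
    moreover have "F (8 / 3 * m) = m * m * (10 / 9 * m - 44 / 3) + (82 / 3 * m - 15)"
      by (simp add: F_def field_simps power2_eq_square power3_eq_cube)
    moreover have "0 \<le> m * m * (10 / 9 * m - 44 / 3)" using False by (intro mult_nonneg_nonneg) auto
    ultimately show ?thesis using False by linarith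
  qed
  moreover have "m * ((N - 2) * (N - 3)) - (3 * ((N - 2) * (N - 3)) + (m - 1) * (m - 2) * (N - 3) + (m - 1) * (N - 3)
     + (m - 2) * (m - 2) * (N - m) + (m - 2) * (m - 1) * (N - m - 1)) = F N + (m - 2) * (m - 1)"
    by (simp add: F_def algebra_simps power2_eq_square power3_eq_cube)
  moreover have "0 \<le> (m - 2) * (m - 1)" using m by simp
  ultimately show ?thesis by linarith
qed

section \<open>Counting in a four-transitive group\<close>

locale four_transitive =
  fixes G :: "('a::finite \<Rightarrow> 'a) set"
  assumes G: "perm_group G"
    and trans4: "\<lbrakk>distinct [a, b, c, d]; distinct [a', b', c', d']\<rbrakk> \<Longrightarrow>
      \<exists>g\<in>G. g a = a' \<and> g b = b' \<and> g c = c' \<and> g d = d'"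
    and large: "CARD('a) \<ge> 4"
begin

lemma inj_G: "g \<in> G \<Longrightarrow> g x = g y \<longleftrightarrow> x = y"
  using perm_groupD(2)[OF G] by (simp add: bij_is_inj inj_eq)

text \<open>For distinct points this is a coset of a two-point stabiliser; the averages below are
  taken over it.\<close>

definition moving :: "'a \<Rightarrow> 'a \<Rightarrow> 'a \<Rightarrow> 'a \<Rightarrow> ('a \<Rightarrow> 'a) set" where
  "moving a b a' b' = {g \<in> G. g a = a' \<and> g b = b'}"

text \<open>Multiplying by \<open>h\<close> on one side and by \<open>k\<close> on the other embeds
  the first set into the second; since the roles can be exchanged, all such sets have the same
  size.\<close>

lemma card_moving4_le:
  assumes "distinct [a, b, c, d]" "distinct [a', b', c', d']"
    "distinct [p, q, r, s]" "distinct [p', q', r', s']"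
  shows "card {g \<in> moving a b a' b'. g c = c' \<and> g d = d'} \<le> card {g \<in> moving p q p' q'. g r = r' \<and> g s = s'}"
proof -
  obtain h where h: "h \<in> G" "h p = a" "h q = b" "h r = c" "h s = d"
    using trans4[OF assms(3,1)] by blast
  obtain k where k: "k \<in> G" "k a' = p'" "k b' = q'" "k c' = r'" "k d' = s'"
    using trans4[OF assms(2,4)] by blast
  show ?thesis
  proof (rule card_inj_on_le[where f = "\<lambda>g. k \<circ> g \<circ> h"])
    have "f = g" if "k \<circ> f \<circ> h = k \<circ> g \<circ> h" for f g
    proof
      fix x
      obtain y where "x = h y" using perm_groupD(2)[OF G h(1)] by (metis bij_pointE)
      moreover have "k (f (h y)) = k (g (h y))" using that by (metis comp_apply)
      ultimately show "f x = g x" using inj_G[OF k(1)] by simp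
    qed
    then show "inj_on (\<lambda>g. k \<circ> g \<circ> h) {g \<in> moving a b a' b'. g c = c' \<and> g d = d'}" by (auto simp: inj_on_def)
    show "(\<lambda>g. k \<circ> g \<circ> h) ` {g \<in> moving a b a' b'. g c = c' \<and> g d = d'} \<subseteq> {g \<in> moving p q p' q'. g r = r' \<and> g s = s'}"
      using h k perm_groupD(4)[OF G] by (auto simp: moving_def)
  qed simp
qed

text \<open>The constant is the order of a four-point stabiliser, positive because of the
  identity.\<close>

lemma card_moving4_const:
  obtains \<kappa> where "\<kappa> > 0" "\<And>a b c d a' b' c' d'. \<lbrakk>distinct [a, b, c, d]; distinct [a', b', c', d']\<rbrakk> \<Longrightarrow>
      card {g \<in> moving a b a' b'. g c = c' \<and> g d = d'} = \<kappa>"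
proof -
  obtain A :: "'a set" where "card A = 4" using large by (metis obtain_subset_with_card_n)
  obtain xs where xs: "set xs = A" "distinct xs" using finite_distinct_list[of A] by auto
  have "length xs = Suc (Suc (Suc (Suc 0)))" using distinct_card[OF xs(2)] xs(1) \<open>card A = 4\<close> by simp
  then obtain p q r s where "xs = [p, q, r, s]" by (auto simp: length_Suc_conv)
  then have d: "distinct [p, q, r, s]" using xs(2) by simp
  let ?K = "{g \<in> moving p q p q. g r = r \<and> g s = s}"
  have "id \<in> ?K" using perm_groupD(1)[OF G] by (simp add: moving_def)
  then have "?K \<noteq> {}" by blast
  then have "card ?K > 0" by (simp add: card_gt_0_iff)
  then show ?thesis
  proof (rule that)
    fix a b c e a' b' c' e' :: 'a assume *: "distinct [a, b, c, e]" "distinct [a', b', c', e']"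
    show "card {g \<in> moving a b a' b'. g c = c' \<and> g e = e'} = card ?K"
      by (rule le_antisym) (rule card_moving4_le[OF * d d], rule card_moving4_le[OF d d *])
  qed
qed

context
  fixes \<kappa> a b a' b'
  assumes \<kappa>: "\<forall>c d c' d'. distinct [a, b, c, d] \<longrightarrow> distinct [a', b', c', d'] \<longrightarrow>
      card {g \<in> moving a b a' b'. g c = c' \<and> g d = d'} = \<kappa>"
    and ab: "a \<noteq> b" "a' \<noteq> b'"
begin

lemma card_moving_pair:
  assumes "distinct [a, b, c, d]" "A \<inter> {a', b'} = {}" "B \<inter> {a', b'} = {}" "A \<inter> B = {}"
  shows "card {g \<in> moving a b a' b'. g c \<in> A \<and> g d \<in> B} = card A * card B * \<kappa>"
proof -
  have "card {g \<in> moving a b a' b'. g c \<in> A \<and> g d \<in> B} = card (A \<times> B) * \<kappa>"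
  proof (rule card_eq_mult_fibre_card[where f = "\<lambda>g. (g c, g d)"])
    fix p assume p: "p \<in> A \<times> B"
    then have "{g \<in> {g \<in> moving a b a' b'. g c \<in> A \<and> g d \<in> B}. (g c, g d) = p}
      = {g \<in> moving a b a' b'. g c = fst p \<and> g d = snd p}" by auto
    then show "card {g \<in> {g \<in> moving a b a' b'. g c \<in> A \<and> g d \<in> B}. (g c, g d) = p} = \<kappa>"
      using \<kappa>[rule_format, OF assms(1), of "fst p" "snd p"] p assms ab by fastforce
  qed auto
  then show ?thesis by (simp add: card_cartesian_product)
qed

text \<open>An auxiliary point \<open>d\<close> reduces this to constant fibres: its image ranges
  over the \<open>CARD('a) - 3\<close> points distinct from the three images already chosen.\<close>

lemma card_moving_single:
  assumes "distinct [a, b, c]" "A \<inter> {a', b'} = {}"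
  shows "card {g \<in> moving a b a' b'. g c \<in> A} = card A * (CARD('a) - 3) * \<kappa>"
proof -
  have "card {a, b, c} < CARD('a)" using large card_length[of "[a, b, c]"] by auto
  then obtain d where d: "d \<notin> {a, b, c}" by (metis UNIV_eq_I less_irrefl)
  then have dist: "distinct [a, b, c, d]" using assms by auto
  let ?P = "SIGMA x:A. - {a', b', x}"
  have "card {g \<in> moving a b a' b'. g c \<in> A} = card ?P * \<kappa>"
  proof (rule card_eq_mult_fibre_card[where f = "\<lambda>g. (g c, g d)"])
    show "(\<lambda>g. (g c, g d)) ` {g \<in> moving a b a' b'. g c \<in> A} \<subseteq> ?P"
      using dist inj_G by (auto simp: moving_def)
    fix p assume p: "p \<in> ?P"
    then have "{g \<in> {g \<in> moving a b a' b'. g c \<in> A}. (g c, g d) = p}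
      = {g \<in> moving a b a' b'. g c = fst p \<and> g d = snd p}" by auto
    then show "card {g \<in> {g \<in> moving a b a' b'. g c \<in> A}. (g c, g d) = p} = \<kappa>"
      using \<kappa>[rule_format, OF dist, of "fst p" "snd p"] p assms ab by fastforce
  qed auto
  also have "card ?P = (\<Sum>x\<in>A. card (- {a', b', x}))" by simp
  also have "\<dots> = (\<Sum>x\<in>A. CARD('a) - 3)"
  proof (rule sum.cong)
    fix x assume "x \<in> A"
    then have "x \<noteq> a'" "x \<noteq> b'" using assms(2) by auto
    then have "card {a', b', x} = 3" using ab by auto
    then show "card (- {a', b', x}) = CARD('a) - 3" by (simp add: card_Compl_finite)
  qed simp
  finally show ?thesis by simp
qed

lemma card_moving: "card (moving a b a' b') = (CARD('a) - 2) * (CARD('a) - 3) * \<kappa>"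
proof -
  have "card {a, b} < CARD('a)" using large card_length[of "[a, b]"] by auto
  then obtain c where c: "c \<notin> {a, b}" by (metis UNIV_eq_I less_irrefl)
  have "moving a b a' b' = {g \<in> moving a b a' b'. g c \<in> - {a', b'}}"
    using c inj_G by (auto simp: moving_def)
  then have "card (moving a b a' b') = card (- {a', b'}) * (CARD('a) - 3) * \<kappa>"
    using card_moving_single[of c "- {a', b'}"] c ab by auto
  moreover have "card {a', b'} = 2" using ab by simp
  ultimately show ?thesis by (simp only: card_Compl_finite)
qed

end

text \<open>
  Bochert's argument: a suitable commutator of \<open>x\<close> with a random conjugate of \<open>x\<close> has, on average,
  fewer moved points than \<open>x\<close>.
\<close>

lemma degree_descent:
  assumes x: "x \<in> G" and M: "M = {z. x z \<noteq> z}"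
    and bounds: "4 \<le> card M" "8 * card M \<le> 3 * CARD('a)" "64 \<le> CARD('a)"
  shows "\<exists>w\<in>G. w \<noteq> id \<and> card {z. w z \<noteq> z} < card M"
proof -
  define m where "m = card M"
  define N where "N = CARD('a)"
  have bx: "bij x" and ix: "\<And>y z. x y = x z \<longleftrightarrow> y = z" using perm_groupD(2)[OF G x] inj_G[OF x] by auto
  have xM: "x z \<in> M \<longleftrightarrow> z \<in> M" for z using ix by (auto simp: M)
  obtain \<alpha> where \<alpha>: "\<alpha> \<in> M" using bounds(1) by (metis card.empty ex_in_conv not_numeral_le_zero)
  define \<beta> where "\<beta> = x \<alpha>"
  have \<beta>: "\<beta> \<in> M" "\<beta> \<noteq> \<alpha>" using \<alpha> xM by (auto simp: \<beta>_def M)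
  have "M \<noteq> UNIV" using bounds by auto
  then obtain e0 where e0: "e0 \<notin> M" by blast
  have xe0: "x e0 = e0" using e0 by (simp add: M)
  define e1 where "e1 = \<beta>"
  have e1: "e1 \<in> M" "e1 \<noteq> e0" using \<beta> e0 by (auto simp: e1_def)
  \<comment> \<open>For \<open>g \<in> A\<close> the conjugate \<open>y\<close> of \<open>x\<close>
    by \<open>g\<close> fixes \<open>\<alpha>\<close>, since \<open>x\<close> fixes
    \<open>e0\<close>, but moves \<open>\<beta> = x \<alpha>\<close>, since \<open>x\<close> moves
    \<open>e1\<close>. Hence \<open>x\<close> and \<open>y\<close> do not commute and their
    commutator is not the identity.\<close>
  define A where "A = moving e0 e1 \<alpha> \<beta>"
  define A' where "A' = moving \<alpha> \<beta> e0 e1"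
  obtain \<kappa> where \<kappa>: "\<kappa> > 0" "\<And>a b c d a' b' c' d'. \<lbrakk>distinct [a, b, c, d]; distinct [a', b', c', d']\<rbrakk> \<Longrightarrow>
      card {g \<in> moving a b a' b'. g c = c' \<and> g d = d'} = \<kappa>"
    using card_moving4_const by blast
  have \<kappa>': "\<forall>c d c' d'. distinct [a, b, c, d] \<longrightarrow> distinct [a', b', c', d'] \<longrightarrow>
      card {g \<in> moving a b a' b'. g c = c' \<and> g d = d'} = \<kappa>" for a b a' b'
    using \<kappa>(2) by blast
  note pairA = card_moving_pair[OF \<kappa>' e1(2)[symmetric] \<beta>(2)[symmetric], folded A_def]
  note singleA = card_moving_single[OF \<kappa>' e1(2)[symmetric] \<beta>(2)[symmetric], folded A_def N_def]
  note pairA' = card_moving_pair[OF \<kappa>' \<beta>(2)[symmetric] e1(2)[symmetric], folded A'_def]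
  note singleA' = card_moving_single[OF \<kappa>' \<beta>(2)[symmetric] e1(2)[symmetric], folded A'_def N_def]
  have cardA: "card A = (N - 2) * (N - 3) * \<kappa>" "card A' = (N - 2) * (N - 3) * \<kappa>"
    using card_moving[OF \<kappa>' e1(2)[symmetric] \<beta>(2)[symmetric]]
      card_moving[OF \<kappa>' \<beta>(2)[symmetric] e1(2)[symmetric]] by (simp_all add: A_def A'_def N_def)
  \<comment> \<open>With \<open>S\<close> the set of points moved by both \<open>x\<close> and
    \<open>y\<close>, these numbers are the size of \<open>S\<close> and bounds for the parts of
    x(S) and y(S) outside \<open>S\<close>; together they bound the support of the
    commutator.\<close>
  define c1 where "c1 g = card {z \<in> M. g z \<in> M}" for g
  define c2 where "c2 g = card {z \<in> M. inv g z \<in> M \<and> inv g (x z) \<notin> M}" for g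
  define c3 where "c3 g = card {z \<in> M. g z \<in> M \<and> g (x z) \<notin> M}" for g
  have AG: "g \<in> G" "g e0 = \<alpha>" "g e1 = \<beta>" if "g \<in> A" for g using that by (auto simp: A_def moving_def)
  have AG': "g \<in> G" "g \<alpha> = e0" "g \<beta> = e1" if "g \<in> A'" for g using that by (auto simp: A'_def moving_def)
  have m2: "card (M - {\<alpha>, \<beta>}) = m - 2" using \<alpha> \<beta> by (simp add: card_Diff_subset m_def)
  have m1: "card (M - {z}) = m - 1" if "z \<in> M" for z using that by (simp add: m_def)

  \<comment> \<open>The point \<open>e1\<close> always lands in \<open>M\<close> and is charged with
    all of \<open>A\<close>; every other point avoids the values \<open>\<alpha>\<close> and
    \<open>\<beta>\<close>.\<close>
  have "(\<Sum>g\<in>A. c1 g) = (\<Sum>z\<in>M. card {g \<in> A. g z \<in> M})" unfolding c1_def by (rule sum_card_swap) auto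
  also have "\<dots> = card {g \<in> A. g e1 \<in> M} + (\<Sum>z\<in>M - {e1}. card {g \<in> A. g z \<in> M})"
    by (rule sum.remove) (use e1 in auto)
  also have "(\<Sum>z\<in>M - {e1}. card {g \<in> A. g z \<in> M}) = (\<Sum>z\<in>M - {e1}. (m - 2) * (N - 3) * \<kappa>)"
  proof (rule sum.cong)
    fix z assume z: "z \<in> M - {e1}"
    then have d: "distinct [e0, e1, z]" using e0 e1 by auto
    have "g z \<noteq> \<alpha> \<and> g z \<noteq> \<beta>" if "g \<in> A" for g
      using d unfolding AG(2,3)[OF that, symmetric] inj_G[OF AG(1)[OF that]] by auto
    then have "{g \<in> A. g z \<in> M} = {g \<in> A. g z \<in> M - {\<alpha>, \<beta>}}" by blast
    then show "card {g \<in> A. g z \<in> M} = (m - 2) * (N - 3) * \<kappa>"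
      using singleA[OF d, of "M - {\<alpha>, \<beta>}"] m2 by simp
  qed simp
  also have "card {g \<in> A. g e1 \<in> M} \<le> card A" by (intro card_mono) auto
  finally have s1: "(\<Sum>g\<in>A. c1 g) \<le> card A + (m - 1) * ((m - 2) * (N - 3) * \<kappa>)"
    using m1[OF e1(1)] by simp

  \<comment> \<open>The point with \<open>x e2 = e1\<close> contributes nothing, as
    \<open>g e1 = \<beta>\<close> lies in \<open>M\<close>. For the remaining \<open>z\<close> the
    points \<open>e0\<close>, \<open>e1\<close>, \<open>z\<close>, \<open>x z\<close> are distinct,
    so images of pairs can be counted.\<close>
  define e2 where "e2 = inv x e1"
  have e2: "x e2 = e1" using bx by (simp add: e2_def bij_is_surj surj_f_inv_f)
  have e2M: "e2 \<in> M" "e2 \<noteq> e1" using e2 e1 xM[of e2] by (auto simp: M)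
  have cM: "card (M - {e1} - {e2}) = m - 2" using e1 e2M by (simp add: m_def numeral_2_eq_2)
  have "(\<Sum>g\<in>A. c3 g) = (\<Sum>z\<in>M. card {g \<in> A. g z \<in> M \<and> g (x z) \<notin> M})"
    unfolding c3_def by (rule sum_card_swap) auto
  also have "\<dots> = card {g \<in> A. g e1 \<in> M \<and> g (x e1) \<notin> M} + (card {g \<in> A. g e2 \<in> M \<and> g (x e2) \<notin> M}
      + (\<Sum>z\<in>M - {e1} - {e2}. card {g \<in> A. g z \<in> M \<and> g (x z) \<notin> M}))"
    by (rule sum_remove2) (use e1 e2M in auto)
  also have "(\<Sum>z\<in>M - {e1} - {e2}. card {g \<in> A. g z \<in> M \<and> g (x z) \<notin> M})
      = (\<Sum>z\<in>M - {e1} - {e2}. (m - 2) * (N - m) * \<kappa>)"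
  proof (rule sum.cong)
    fix z assume z: "z \<in> M - {e1} - {e2}"
    have "x z \<noteq> e1" using z e2 ix by auto
    moreover have "x z \<noteq> z" "x z \<in> M" using z xM by (auto simp: M)
    ultimately have d: "distinct [e0, e1, z, x z]" using z e0 e1 by auto
    have "{g \<in> A. g z \<in> M \<and> g (x z) \<notin> M} = {g \<in> A. g z \<in> M - {\<alpha>, \<beta>} \<and> g (x z) \<in> - M}"
    proof -
      have "g z \<noteq> \<alpha> \<and> g z \<noteq> \<beta>" if "g \<in> A" for g
        using d unfolding AG(2,3)[OF that, symmetric] inj_G[OF AG(1)[OF that]] by auto
      then show ?thesis by blast
    qed
    moreover have "(M - {\<alpha>, \<beta>}) \<inter> {\<alpha>, \<beta>} = {}" "- M \<inter> {\<alpha>, \<beta>} = {}" "(M - {\<alpha>, \<beta>}) \<inter> - M = {}"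
      using \<alpha> \<beta> by auto
    ultimately show "card {g \<in> A. g z \<in> M \<and> g (x z) \<notin> M} = (m - 2) * (N - m) * \<kappa>"
      using pairA[OF d, of "M - {\<alpha>, \<beta>}" "- M"] m2 by (simp add: card_Compl_finite m_def N_def)
  qed simp
  also have "{g \<in> A. g e2 \<in> M \<and> g (x e2) \<notin> M} = {}" using AG e2 \<beta> by auto
  also have "card {g \<in> A. g e1 \<in> M \<and> g (x e1) \<notin> M} \<le> card A" by (intro card_mono) auto
  finally have s3: "(\<Sum>g\<in>A. c3 g) \<le> card A + (m - 2) * ((m - 2) * (N - m) * \<kappa>)"
    using cM by simp

  \<comment> \<open>Inversion turns the sum of \<open>c2\<close> over \<open>A\<close> into a sum of
    the same shape as that of \<open>c3\<close>, taken over \<open>A'\<close>.\<close>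
  have A_inv: "inv ` A = A'"
  proof -
    have "inv g \<in> A'" if "g \<in> A" for g
    proof -
      have "inj g" using perm_groupD(2)[OF G AG(1)[OF that]] by (rule bij_is_inj)
      then have "inv g \<alpha> = e0" "inv g \<beta> = e1" using AG(2,3)[OF that] by (blast intro: inv_f_eq)+
      then show ?thesis using perm_groupD(3)[OF G AG(1)[OF that]] by (simp add: A'_def moving_def)
    qed
    moreover have "g \<in> inv ` A" if "g \<in> A'" for g
    proof
      have "inj g" using perm_groupD(2)[OF G AG'(1)[OF that]] by (rule bij_is_inj)
      then have "inv g e0 = \<alpha>" "inv g e1 = \<beta>" using AG'(2,3)[OF that] by (blast intro: inv_f_eq)+
      then show "inv g \<in> A" using perm_groupD(3)[OF G AG'(1)[OF that]] by (simp add: A_def moving_def)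
      show "g = inv (inv g)" by (rule inv_inv_eq[OF perm_groupD(2)[OF G AG'(1)[OF that]], symmetric])
    qed
    ultimately show ?thesis by blast
  qed
  have A_inj: "inj_on inv A"
  proof (rule inj_onI)
    fix f g assume fg: "f \<in> A" "g \<in> A" "inv f = inv g"
    have "f = inv (inv f)" by (rule inv_inv_eq[OF perm_groupD(2)[OF G AG(1)[OF fg(1)]], symmetric])
    also have "inv (inv f) = inv (inv g)" by (simp only: fg(3))
    also have "inv (inv g) = g" by (rule inv_inv_eq[OF perm_groupD(2)[OF G AG(1)[OF fg(2)]]])
    finally show "f = g" .
  qed
  have "(\<Sum>g\<in>A. c2 g) = (\<Sum>g\<in>A'. card {z \<in> M. g z \<in> M \<and> g (x z) \<notin> M})"
    unfolding A_inv[symmetric] c2_def by (simp add: sum.reindex[OF A_inj])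
  also have "\<dots> = (\<Sum>z\<in>M. card {g \<in> A'. g z \<in> M \<and> g (x z) \<notin> M})" by (rule sum_card_swap) auto
  also have "\<dots> = card {g \<in> A'. g \<alpha> \<in> M \<and> g (x \<alpha>) \<notin> M} + (card {g \<in> A'. g \<beta> \<in> M \<and> g (x \<beta>) \<notin> M}
      + (\<Sum>z\<in>M - {\<alpha>} - {\<beta>}. card {g \<in> A'. g z \<in> M \<and> g (x z) \<notin> M}))"
    by (rule sum_remove2) (use \<alpha> \<beta> in auto)
  also have "{g \<in> A'. g \<alpha> \<in> M \<and> g (x \<alpha>) \<notin> M} = {}" using AG' e0 by auto
  also have "card {g \<in> A'. g \<beta> \<in> M \<and> g (x \<beta>) \<notin> M} \<le> card A'" by (intro card_mono) auto
  \<comment> \<open>The exceptional point is the one with \<open>x z = \<alpha>\<close>: there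
    \<open>x z\<close> is sent to \<open>e0\<close> outside \<open>M\<close>, so only the image of
    \<open>z\<close> is still free.\<close>
  also have "(\<Sum>z\<in>M - {\<alpha>} - {\<beta>}. card {g \<in> A'. g z \<in> M \<and> g (x z) \<notin> M})
      \<le> (\<Sum>z\<in>M - {\<alpha>} - {\<beta>}. (m - 1) * (N - m - 1) * \<kappa> + (if z = inv x \<alpha> then (m - 1) * (N - 3) * \<kappa> else 0))"
  proof (rule sum_mono)
    fix z assume z: "z \<in> M - {\<alpha>} - {\<beta>}"
    have inM: "g z \<noteq> e0 \<and> g z \<noteq> e1" if "g \<in> A'" for g
      using z unfolding AG'(2,3)[OF that, symmetric] inj_G[OF AG'(1)[OF that]] by simp
    show "card {g \<in> A'. g z \<in> M \<and> g (x z) \<notin> M}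
      \<le> (m - 1) * (N - m - 1) * \<kappa> + (if z = inv x \<alpha> then (m - 1) * (N - 3) * \<kappa> else 0)"
    proof (cases "z = inv x \<alpha>")
      case True
      have "card {g \<in> A'. g z \<in> M \<and> g (x z) \<notin> M} \<le> card {g \<in> A'. g z \<in> M - {e1}}"
        using inM by (intro card_mono) auto
      also have "\<dots> = (m - 1) * (N - 3) * \<kappa>"
      proof -
        have "distinct [\<alpha>, \<beta>, z]" "(M - {e1}) \<inter> {e0, e1} = {}" using z \<beta> e0 by auto
        then show ?thesis using singleA'[of z "M - {e1}"] m1[OF e1(1)] by simp
      qed
      finally show ?thesis using True by simp
    next
      case False
      then have "x z \<noteq> \<alpha>" using bx by (metis bij_is_inj inv_f_f)
      moreover have "x z \<noteq> z" "x z \<noteq> \<beta>" using z ix by (auto simp: M \<beta>_def)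
      ultimately have d: "distinct [\<alpha>, \<beta>, z, x z]" using z \<beta> by auto
      have "g (x z) \<noteq> e0" if "g \<in> A'" for g
        using d unfolding AG'(2)[OF that, symmetric] inj_G[OF AG'(1)[OF that]] by auto
      then have "{g \<in> A'. g z \<in> M \<and> g (x z) \<notin> M} = {g \<in> A'. g z \<in> M - {e1} \<and> g (x z) \<in> - M - {e0}}"
        using inM by blast
      moreover have "card (- M - {e0}) = N - m - 1" using e0 by (simp add: card_Compl_finite m_def N_def)
      moreover have "(M - {e1}) \<inter> {e0, e1} = {}" "(- M - {e0}) \<inter> {e0, e1} = {}" "(M - {e1}) \<inter> (- M - {e0}) = {}"
        using e0 e1 by auto
      ultimately show ?thesis
        using pairA'[OF d, of "M - {e1}" "- M - {e0}"] m1[OF e1(1)] by simp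
    qed
  qed
  also have "\<dots> \<le> (m - 2) * ((m - 1) * (N - m - 1) * \<kappa>) + (m - 1) * (N - 3) * \<kappa>"
  proof -
    have "card (M - {\<alpha>} - {\<beta>}) = m - 2" using \<alpha> \<beta> by (simp add: m_def numeral_2_eq_2)
    moreover have "(\<Sum>z\<in>B. if z = t then c else 0) \<le> c" if "finite B" for B :: "'a set" and t and c :: nat
      using that by (simp add: sum.delta)
    ultimately show ?thesis by (simp only: sum.distrib sum_constant of_nat_id) (simp add: add_left_mono)
  qed
  finally have s2: "(\<Sum>g\<in>A. c2 g) \<le> card A' + ((m - 2) * ((m - 1) * (N - m - 1) * \<kappa>) + (m - 1) * (N - 3) * \<kappa>)"
    by simp

  \<comment> \<open>The average is below \<open>m\<close>: otherwise summing over \<open>A\<close>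
    and cancelling \<open>\<kappa>\<close> contradicts
    \<open>minimal_degree_inequality\<close>.\<close>
  have "\<exists>g\<in>A. c1 g + c2 g + c3 g < m"
  proof (rule ccontr)
    assume "\<not> ?thesis"
    then have "(\<Sum>g\<in>A. m) \<le> (\<Sum>g\<in>A. c1 g + c2 g + c3 g)" by (intro sum_mono) (simp add: not_less)
    then have "m * card A \<le> (\<Sum>g\<in>A. c1 g) + (\<Sum>g\<in>A. c2 g) + (\<Sum>g\<in>A. c3 g)"
      by (simp add: sum.distrib mult.commute)
    also have "\<dots> \<le> (3 * ((N - 2) * (N - 3)) + (m - 1) * (m - 2) * (N - 3) + (m - 1) * (N - 3)
        + (m - 2) * (m - 2) * (N - m) + (m - 2) * (m - 1) * (N - m - 1)) * \<kappa>"
      using s1 s2 s3 cardA by (simp add: add_mult_distrib add_mult_distrib2 ac_simps)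
    finally have "m * ((N - 2) * (N - 3)) * \<kappa> \<le> (3 * ((N - 2) * (N - 3)) + (m - 1) * (m - 2) * (N - 3) + (m - 1) * (N - 3)
        + (m - 2) * (m - 2) * (N - m) + (m - 2) * (m - 1) * (N - m - 1)) * \<kappa>"
      using cardA by (simp add: ac_simps)
    then have le: "m * ((N - 2) * (N - 3)) \<le> 3 * ((N - 2) * (N - 3)) + (m - 1) * (m - 2) * (N - 3) + (m - 1) * (N - 3)
        + (m - 2) * (m - 2) * (N - m) + (m - 2) * (m - 1) * (N - m - 1)"
      using \<kappa>(1) by simp
    have b: "4 \<le> m" "8 * m \<le> 3 * N" "64 \<le> N" using bounds by (auto simp: m_def N_def)
    have "real (m * ((N - 2) * (N - 3))) \<le> real (3 * ((N - 2) * (N - 3)) + (m - 1) * (m - 2) * (N - 3) + (m - 1) * (N - 3)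
        + (m - 2) * (m - 2) * (N - m) + (m - 2) * (m - 1) * (N - m - 1))"
      using le by (rule of_nat_mono)
    moreover have "real (N - 2) = real N - 2" "real (N - 3) = real N - 3" "real (m - 1) = real m - 1"
      "real (m - 2) = real m - 2" "real (N - m) = real N - real m" "real (N - m - 1) = real N - real m - 1"
      using b by (auto simp: of_nat_diff)
    ultimately show False using minimal_degree_inequality[of "real m" "real N"] b
      by (simp add: diff_diff_eq add.commute)
  qed
  then obtain g where g: "g \<in> A" "c1 g + c2 g + c3 g < m" by blast
  note gA = AG[OF g(1)]
  have bg: "bij g" and ig: "\<And>y z. g y = g z \<longleftrightarrow> y = z" using perm_groupD(2)[OF G gA(1)] inj_G[OF gA(1)] by auto
  have igf: "inv g (g z) = z" "g (inv g z) = z" for z using bg by (simp_all add: bij_is_inj bij_is_surj surj_f_inv_f)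
  have ixf: "inv x (x z) = z" "x (inv x z) = z" for z using bx by (simp_all add: bij_is_inj bij_is_surj surj_f_inv_f)
  define y where "y = g \<circ> x \<circ> inv g"
  have yG: "y \<in> G" using x gA perm_groupD(3,4)[OF G] by (simp add: y_def)
  have bij_y: "bij y" using perm_groupD(2)[OF G yG] .
  have iyf: "inv y (y z) = z" "y (inv y z) = z" for z using bij_y by (simp_all add: bij_is_inj bij_is_surj surj_f_inv_f)
  define w where "w = x \<circ> y \<circ> inv x \<circ> inv y"
  have wG: "w \<in> G" using x yG perm_groupD(3,4)[OF G] by (simp add: w_def)
  have y\<alpha>: "y \<alpha> = \<alpha>" using gA xe0 igf by (metis comp_apply y_def)
  have y\<beta>: "y \<beta> \<noteq> \<beta>" using e1(1) ig[of "x e1" e1] igf(1)[of e1] by (simp add: y_def M gA(3)[symmetric])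
  have "w \<noteq> id"
  proof
    assume "w = id"
    then have "w (y (x \<alpha>)) = y (x \<alpha>)" by simp
    moreover have "w (y (x \<alpha>)) = x (y \<alpha>)" by (simp add: w_def iyf ixf)
    ultimately show False using y\<alpha> y\<beta> by (simp add: \<beta>_def)
  qed
  define S where "S = {z \<in> M. y z \<noteq> z}"
  have yz: "y z \<noteq> z \<longleftrightarrow> inv g z \<in> M" for z
    using ig[of "x (inv g z)" "inv g z"] by (simp add: y_def M igf)
  \<comment> \<open>If \<open>y\<close> fixes \<open>z\<close>, then \<open>z\<close> can only move
    when \<open>inv x z\<close> is moved by both \<open>x\<close> and \<open>y\<close>. If
    \<open>y\<close> moves \<open>z\<close> and \<open>z \<notin> S\<close>, then \<open>x\<close>
    fixes \<open>z\<close>, and unless \<open>inv y z \<in> S\<close> it fixes that point as well,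
    so the commutator fixes \<open>z\<close>.\<close>
  have "{z. w z \<noteq> z} \<subseteq> S \<union> (x ` S - S) \<union> (y ` S - S)"
  proof
    fix z assume "z \<in> {z. w z \<noteq> z}"
    then have wz: "x (y (inv x (inv y z))) \<noteq> z" by (simp add: w_def)
    show "z \<in> S \<union> (x ` S - S) \<union> (y ` S - S)"
    proof (rule ccontr)
      assume "z \<notin> S \<union> (x ` S - S) \<union> (y ` S - S)"
      then have n: "z \<notin> S" "z \<notin> x ` S" "z \<notin> y ` S" by auto
      show False
      proof (cases "y z = z")
        case True
        then have "inv y z = z" by (metis iyf(1))
        moreover have "y (inv x z) = inv x z"
        proof (rule ccontr)
          assume "y (inv x z) \<noteq> inv x z"
          moreover have "inv x z \<notin> S" using n(2) ixf(2) by (metis imageI)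
          ultimately have "inv x z \<notin> M" by (simp add: S_def)
          then have "x (inv x z) = inv x z" by (simp add: M)
          then have "inv x z = z" by (simp add: ixf)
          then show False using \<open>y (inv x z) \<noteq> inv x z\<close> True by simp
        qed
        ultimately show False using wz by (simp add: ixf)
      next
        case False
        then have zM: "z \<notin> M" using n(1) by (simp add: S_def)
        have "inv y z \<notin> S" using n(3) iyf(2) by (metis imageI)
        moreover have "y (inv y z) \<noteq> inv y z" using False iyf(2) by metis
        ultimately have "inv y z \<notin> M" by (simp add: S_def)
        then have "inv x (inv y z) = inv y z" using ixf(1) by (metis (mono_tags) M mem_Collect_eq)
        then show False using wz zM by (simp add: iyf M)
      qed
    qed
  qed
  then have "card {z. w z \<noteq> z} \<le> card (S \<union> (x ` S - S) \<union> (y ` S - S))" by (intro card_mono) auto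
  also have "\<dots> \<le> card S + card (x ` S - S) + card (y ` S - S)"
    by (meson card_Un_le le_trans add_le_mono1)
  also have "card S = c1 g"
  proof -
    have "S = g ` {z \<in> M. g z \<in> M}" by (auto simp: S_def yz image_iff igf) (metis igf(2))
    then show ?thesis using ig by (simp add: c1_def card_image inj_on_def)
  qed
  also have "card (x ` S - S) \<le> c2 g"
  proof -
    have "x ` S - S \<subseteq> x ` {z \<in> M. inv g z \<in> M \<and> inv g (x z) \<notin> M}" using xM by (auto simp: S_def yz)
    then show ?thesis unfolding c2_def by (meson card_image_le card_mono finite le_trans)
  qed
  also have "card (y ` S - S) \<le> c3 g"
  proof -
    have "y ` S - S \<subseteq> (\<lambda>z. g (x z)) ` {z \<in> M. g z \<in> M \<and> g (x z) \<notin> M}"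
    proof
      fix t assume t: "t \<in> y ` S - S"
      then obtain z where z: "t = y z" "z \<in> M" "inv g z \<in> M" by (auto simp: S_def yz)
      have t': "t = g (x (inv g z))" by (simp add: z y_def)
      then have "inv g t \<in> M" using z xM by (simp add: igf)
      then have "t \<notin> M" using t by (simp add: S_def yz)
      then show "t \<in> (\<lambda>z. g (x z)) ` {z \<in> M. g z \<in> M \<and> g (x z) \<notin> M}"
        using z t' by (intro image_eqI[of _ _ "inv g z"]) (auto simp: igf)
    qed
    then show ?thesis unfolding c3_def by (meson card_image_le card_mono finite le_trans)
  qed
  finally have "card {z. w z \<noteq> z} < card M" using g(2) by (simp add: m_def)
  then show ?thesis using wG \<open>w \<noteq> id\<close> by blast
qed

text \<open>A non-identity element of least degree moves at most three points by
  \<open>degree_descent\<close>. Evenness excludes a transposition, so it is a three-cycle, and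
  transitivity makes all three-cycles conjugate to it.\<close>

lemma Alt_subset:
  assumes even: "G \<subseteq> Alt" and x: "x \<in> G" "x \<noteq> id" "8 * card {z. x z \<noteq> z} \<le> 3 * CARD('a)" and "64 \<le> CARD('a)"
  shows "Alt \<subseteq> G"
proof -
  obtain y where y: "y \<in> G" "y \<noteq> id" "card {z. y z \<noteq> z} \<le> card {z. x z \<noteq> z}"
    and min: "\<And>w. w \<in> G \<Longrightarrow> w \<noteq> id \<Longrightarrow> card {z. y z \<noteq> z} \<le> card {z. w z \<noteq> z}"
    using ex_has_least_nat[of "\<lambda>w. w \<in> G \<and> w \<noteq> id" x "\<lambda>w. card {z. w z \<noteq> z}"] x by blast
  have c3: "card {z. y z \<noteq> z} \<le> 3"
  proof (rule ccontr)
    assume "\<not> card {z. y z \<noteq> z} \<le> 3"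
    then obtain w where "w \<in> G" "w \<noteq> id" "card {z. w z \<noteq> z} < card {z. y z \<noteq> z}"
      using degree_descent[OF y(1) refl] y(3) x(3) assms(5) by auto
    then show False using min[of w] by simp
  qed
  have iy: "y a = y b \<longleftrightarrow> a = b" for a b using inj_G[OF y(1)] .
  obtain a where a: "y a \<noteq> a" using y(2) by (auto simp: fun_eq_iff)
  define b where "b = y a"
  define c where "c = y b"
  have ya: "y a = b" "y b = c" by (simp_all add: b_def c_def)
  have ab: "a \<noteq> b" "b \<noteq> c" "y b \<noteq> b" "y c \<noteq> c" using a iy[of a b] iy[of b c] ya by auto
  have ac: "a \<noteq> c"
  proof
    \<comment> \<open>Then \<open>y\<close> swaps \<open>a\<close> and \<open>b\<close>; another
      moved point \<open>z\<close> would bring \<open>y z\<close> with it, giving four moved points.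
      So \<open>y\<close> would be an odd transposition.\<close>
    assume ac: "a = c"
    have "y z = z" if "z \<noteq> a" "z \<noteq> b" for z
    proof (rule ccontr)
      assume z: "y z \<noteq> z"
      have "y z \<noteq> a" "y z \<noteq> b" using that iy[of z b] iy[of z a] ac ya by auto
      moreover have "y (y z) \<noteq> y z" using z iy by blast
      ultimately have "card {a, b, z, y z} = 4" using ab that z by auto
      moreover have "card {a, b, z, y z} \<le> card {z. y z \<noteq> z}"
        using a ab z \<open>y (y z) \<noteq> y z\<close> by (intro card_mono) auto
      ultimately show False using c3 by simp
    qed
    then have "y = Transposition.transpose a b"
      using ac ya by (auto simp: fun_eq_iff Transposition.transpose_def)
    then show False using even y(1) ab(1) evenperm_swap[of a b] by (auto simp: Alt_def)
  qed
  have abc: "{z. y z \<noteq> z} = {a, b, c}"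
    using c3 ab ac a by (intro card_seteq[symmetric]) auto
  have "y c = a"
  proof -
    have "y (y c) \<noteq> y c" using ab iy by blast
    then have "y c \<in> {a, b, c}" using abc by blast
    moreover have "y c \<noteq> b" using iy[of c a] ya ac by auto
    ultimately show ?thesis using ab by blast
  qed
  then have "y = cyc3 a b c" using ab ac abc ya by (auto simp: fun_eq_iff cyc3_apply)
  show ?thesis
  proof (rule Alt_subset_if_cyc3[OF G])
    fix a' b' c' :: 'a assume d: "a' \<noteq> b'" "a' \<noteq> c'" "b' \<noteq> c'"
    have "card {a, b, c} < CARD('a)" "card {a', b', c'} < CARD('a)"
      using large card_length[of "[a, b, c]"] card_length[of "[a', b', c']"] by auto
    \<comment> \<open>Fourth points, needed only to match the form of \<open>trans4\<close>.\<close>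
    then obtain e e' where "e \<notin> {a, b, c}" "e' \<notin> {a', b', c'}" by (metis UNIV_eq_I less_irrefl)
    then obtain g where g: "g \<in> G" "g a = a'" "g b = b'" "g c = c'"
      using trans4[of a b c e a' b' c' e'] ab ac d by auto
    have "cyc3 a' b' c' = g \<circ> y \<circ> inv g"
      using cyc3_conj[OF perm_groupD(2)[OF G g(1)] ab(1) ac ab(2)] g \<open>y = cyc3 a b c\<close> by simp
    then show "cyc3 a' b' c' \<in> G" using g y perm_groupD(3,4)[OF G] by simp
  qed
qed

end

section \<open>Even permutations\<close>

text \<open>With \<open>g\<close> equal to \<open>f\<close> on the half described by
  \<open>\<phi>\<close> and the identity on the other half, \<open>f\<close> is the product of
  \<open>g\<close> and its conjugate under \<open>t\<close>. Both factors have the same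
  parity.\<close>

lemma evenperm_if_fibres_swapped:
  fixes f t :: "'a::finite \<Rightarrow> 'a"
  assumes "bij f" "bij t" and comm: "\<And>x. f (t x) = t (f x)"
    and f: "\<And>x. \<phi> (f x) = \<phi> x" and t: "\<And>x. \<phi> (t x) = (\<not> \<phi> x)"
  shows "evenperm f"
proof -
  define g where "g x = (if \<phi> x then f x else x)" for x
  have "inj f" using assms(1) by (rule bij_is_inj)
  have "inj g"
  proof (rule injI)
    fix x y assume eq: "g x = g y"
    have "\<phi> (g x) = \<phi> x" for x by (simp add: g_def f)
    then have "\<phi> x = \<phi> y" using eq by metis
    then show "x = y" using eq \<open>inj f\<close> by (auto simp: g_def inj_eq split: if_splits)
  qed
  then have "bij g" by (simp add: bij_def finite_UNIV_inj_surj)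
  have it: "t (inv t x) = x" for x using assms(2) by (simp add: bij_is_surj surj_f_inv_f)
  have "\<phi> (inv t x) = (\<not> \<phi> x)" for x using t[of "inv t x"] by (simp add: it)
  moreover have comm': "f x = t (f (inv t x))" for x using comm[of "inv t x"] by (simp add: it)
  ultimately have "f = g \<circ> (t \<circ> g \<circ> inv t)"
    using f by (auto simp: fun_eq_iff g_def it comm'[symmetric])
  moreover have "evenperm (t \<circ> g \<circ> inv t) = evenperm g"
    using \<open>bij g\<close> \<open>bij t\<close> by (auto simp: evenperm_comp evenperm_inv permutation_of_bij bij_imp_bij_inv bij_comp)
  moreover have "evenperm (g \<circ> (t \<circ> g \<circ> inv t)) = (evenperm g = evenperm (t \<circ> g \<circ> inv t))"
    using \<open>bij g\<close> \<open>bij t\<close> by (intro evenperm_comp permutation_of_bij bij_comp bij_imp_bij_inv)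
  ultimately show ?thesis by simp
qed

section \<open>Parity of bricklayers\<close>

definition lift :: "'n::finite \<Rightarrow> ('a \<Rightarrow> 'a) \<Rightarrow> 'a^'n \<Rightarrow> 'a^'n" where
  "lift i g = (\<lambda>v. \<chi> j. if j = i then g (v $ j) else v $ j)"

lemma lift_nth: "lift i g v $ j = (if j = i then g (v $ j) else v $ j)"
  by (simp add: lift_def)

lemma lift_comp: "lift i f \<circ> lift i g = lift i (f \<circ> g)"
  by (simp add: fun_eq_iff vec_eq_iff lift_nth)

lemma lift_id: "lift i id = id"
  by (simp add: fun_eq_iff vec_eq_iff lift_nth)

lemma lift_bij: "bij g \<Longrightarrow> bij (lift i g)"
  by (rule o_bij[of "lift i (inv g)"]) (simp_all add: lift_comp lift_id bij_is_inj bij_is_surj surj_iff[THEN iffD1])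

lemma lift_inv: "bij g \<Longrightarrow> inv (lift i g) = lift i (inv g)"
  by (rule inv_unique_comp) (simp_all add: lift_comp lift_id bij_is_inj bij_is_surj surj_iff[THEN iffD1])

lemma bricklayer_nth: "bricklayer b v $ j = b j (v $ j)"
  by (simp add: bricklayer_def)

lemma bricklayer_bij: "bricks_ok b \<Longrightarrow> bij (bricklayer b)"
  by (rule o_bij[of "bricklayer (\<lambda>j. inv (b j))"])
    (simp_all add: fun_eq_iff vec_eq_iff bricklayer_nth bricks_ok_def bij_is_inj bij_is_surj surj_f_inv_f)

text \<open>A bricklayer is a product of permutations of single coordinates. Each of these commutes
  with \<open>s\<close> acting on another coordinate \<open>k\<close>, and \<open>s\<close>
  exchanges the two halves given by \<open>\<phi>\<close> of coordinate \<open>k\<close>.\<close>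

lemma even_bricklayer:
  fixes b :: "'n::finite \<Rightarrow> 'a::finite \<Rightarrow> 'a" and s :: "'a \<Rightarrow> 'a"
  assumes "bricks_ok b" "CARD('n) \<ge> 2" and s: "bij s" "\<And>x. \<phi> (s x) = (\<not> \<phi> x)"
  shows "evenperm (bricklayer b)"
proof -
  have lift_even: "evenperm (lift i g)" if "bij g" for i :: 'n and g :: "'a \<Rightarrow> 'a"
  proof -
    have "(UNIV :: 'n set) \<noteq> {i}"
    proof
      assume "(UNIV :: 'n set) = {i}"
      then have "CARD('n) = card {i}" by (rule arg_cong)
      then show False using assms(2) by simp
    qed
    then obtain k where k: "k \<noteq> i" by blast
    show ?thesis
      by (rule evenperm_if_fibres_swapped[of "lift i g" "lift k s" "\<lambda>v. \<phi> (v $ k)"])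
        (use k that s in \<open>auto simp: lift_bij lift_nth vec_eq_iff\<close>)
  qed
  have "evenperm (bricklayer (\<lambda>j. if j \<in> J then b j else id)) \<and> bij (bricklayer (\<lambda>j. if j \<in> J then b j else id))"
    if "finite J" for J
    using that
  proof (induction J)
    case empty
    have "bricklayer (\<lambda>j. if j \<in> {} then b j else id) = id" by (simp add: fun_eq_iff vec_eq_iff bricklayer_nth)
    then show ?case by (metis evenperm_id bij_id)
  next
    case (insert k J)
    have eq: "bricklayer (\<lambda>j. if j \<in> insert k J then b j else id)
      = lift k (b k) \<circ> bricklayer (\<lambda>j. if j \<in> J then b j else id)"
      using insert.hyps by (auto simp: fun_eq_iff vec_eq_iff bricklayer_nth lift_nth)
    have "bij (b k)" using assms(1) by (simp add: bricks_ok_def)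
    then show ?case
      unfolding eq using insert.IH lift_even[of "b k" k] lift_bij[of "b k" k]
      by (simp only: evenperm_comp permutation_of_bij bij_comp)
  qed
  from this[of UNIV] show ?thesis by simp
qed

text \<open>Closure under negation is not required: the groups in question have exponent two.\<close>

definition add_subgroup :: "'a::ab_group_add set \<Rightarrow> bool" where
  "add_subgroup U \<longleftrightarrow> 0 \<in> U \<and> (\<forall>x\<in>U. \<forall>y\<in>U. x + y \<in> U)"

section \<open>Groups of exponent two and the parity of linear maps\<close>

text \<open>The parameter only fixes the type, so that the same facts serve a brick space and the
  whole space.\<close>

locale exponent_two =
  fixes dummy :: "'v::{finite,ab_group_add} itself"
  assumes add_self: "\<And>x :: 'v. x + x = 0"
begin

lemma cancel [simp]: "x + (x + y) = y" "x + y + y = x" "y + x + y = x" "y + (x + y) = x" for x y :: 'v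
proof -
  show "x + (x + y) = y" by (simp add: add.assoc[symmetric] add_self)
  show "x + y + y = x" by (simp add: add.assoc add_self)
  then show *: "y + x + y = x" by (simp add: add.commute[of y x])
  then show "y + (x + y) = x" by (simp add: add.assoc)
qed

lemma add_eq_0 [simp]: "x + y = 0 \<longleftrightarrow> x = y" for x y :: 'v
proof
  assume "x + y = 0"
  then have "x + (x + y) = x" by simp
  then show "x = y" by simp
qed (simp add: add_self)

lemma subgroup_add_iff:
  assumes "add_subgroup (H :: 'v set)" "w \<in> H"
  shows "x + w \<in> H \<longleftrightarrow> x \<in> H" "w + x \<in> H \<longleftrightarrow> x \<in> H"
proof -
  have clos: "\<And>a b. a \<in> H \<Longrightarrow> b \<in> H \<Longrightarrow> a + b \<in> H" using assms(1) by (simp add: add_subgroup_def)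
  show "x + w \<in> H \<longleftrightarrow> x \<in> H" using clos[OF _ assms(2), of "x + w"] clos[OF _ assms(2), of x] by auto
  then show "w + x \<in> H \<longleftrightarrow> x \<in> H" by (simp add: add.commute)
qed

text \<open>Take \<open>H\<close> of largest size containing \<open>F\<close> and avoiding
  \<open>x\<close> and \<open>y\<close>. Enlarging it by any \<open>z \<notin> H\<close> must
  capture \<open>x\<close> or \<open>y\<close>, so \<open>z\<close> lies in the coset of one of
  them. Applied to \<open>x + y\<close>, this shows that the two cosets coincide.\<close>

lemma index_two_subgroup_avoiding:
  assumes F: "add_subgroup (F :: 'v set)" "x \<notin> F" "y \<notin> F"
  obtains H where "add_subgroup H" "F \<subseteq> H" "x \<notin> H" "y \<notin> H" "\<And>z w. z \<notin> H \<Longrightarrow> w \<notin> H \<Longrightarrow> z + w \<in> H"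
proof -
  let ?P = "\<lambda>H. add_subgroup H \<and> F \<subseteq> H \<and> x \<notin> H \<and> y \<notin> H"
  have "\<exists>H. ?P H \<and> (\<forall>H'. ?P H' \<longrightarrow> card H' \<le> card H)"
    by (rule ex_has_greatest_nat[of ?P F card "Suc CARD('v)"]) (use F in \<open>auto simp: less_Suc_eq_le card_mono\<close>)
  then obtain H where H: "?P H" and max: "\<And>H'. ?P H' \<Longrightarrow> card H' \<le> card H" by blast
  have cosets: "x + z \<in> H \<or> y + z \<in> H" if z: "z \<notin> H" for z
  proof (rule ccontr)
    assume no: "\<not> ?thesis"
    define H' where "H' = H \<union> {h + z | h. h \<in> H}"
    have memH': "t \<in> H' \<longleftrightarrow> t \<in> H \<or> t + z \<in> H" for t
    proof -
      have "(\<exists>h. t = h + z \<and> h \<in> H) \<longleftrightarrow> t + z \<in> H"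
      proof
        assume "t + z \<in> H"
        then show "\<exists>h. t = h + z \<and> h \<in> H" by (intro exI[of _ "t + z"]) simp
      qed auto
      then show ?thesis by (simp add: H'_def)
    qed
    have "add_subgroup H'"
    proof -
      have "s + t \<in> H'" if st: "s \<in> H'" "t \<in> H'" for s t
      proof -
        have clos: "\<And>a b. a \<in> H \<Longrightarrow> b \<in> H \<Longrightarrow> a + b \<in> H" using H by (simp add: add_subgroup_def)
        consider "s \<in> H" "t \<in> H" | "s \<in> H" "t + z \<in> H" | "s + z \<in> H" "t \<in> H" | "s + z \<in> H" "t + z \<in> H"
          using st unfolding memH' by blast
        then show ?thesis
        proof cases
          case 2 then show ?thesis using clos[of s "t + z"] by (simp add: memH' add.assoc)
        next
          case 3 then show ?thesis using clos[of "s + z" t] by (simp add: memH' add_ac)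
        next
          case 4
          have eq: "(s + z) + (t + z) = s + t" using cancel(2)[of "s + t" z] by (simp add: add_ac)
          show ?thesis using clos[OF 4] unfolding eq memH' by simp
        qed (use clos memH' in auto)
      qed
      moreover have "0 \<in> H'" using H by (simp add: memH' add_subgroup_def)
      ultimately show ?thesis by (simp add: add_subgroup_def)
    qed
    moreover have "F \<subseteq> H'" "x \<notin> H'" "y \<notin> H'" using H no memH' by auto
    ultimately have "card H' \<le> card H" using max by blast
    moreover have "H \<subset> H'"
    proof
      show "H \<subseteq> H'" by (simp add: H'_def)
      have "0 \<in> H" using H by (simp add: add_subgroup_def)
      then have "z \<in> H'" by (simp add: memH' add_self)
      then show "H \<noteq> H'" using z by blast
    qed
    ultimately show False using psubset_card_mono[of H' H] by simp
  qed
  have clos: "\<And>a b. a \<in> H \<Longrightarrow> b \<in> H \<Longrightarrow> a + b \<in> H" using H by (simp add: add_subgroup_def)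
  have xy: "x + y \<in> H"
  proof (rule ccontr)
    assume "x + y \<notin> H"
    then have "x + (x + y) \<in> H \<or> y + (x + y) \<in> H" by (rule cosets)
    then show False using H by simp
  qed
  have "z + w \<in> H" if "z \<notin> H" "w \<notin> H" for z w
  proof -
    have "x + z \<in> H" if "z \<notin> H" for z
      using cosets[OF that] clos[of "x + y" "y + z"] xy by (auto simp: add.assoc)
    then have "(x + z) + (x + w) \<in> H" using that clos by blast
    moreover have "(x + z) + (x + w) = z + w" using cancel(1)[of x "z + w"] by (simp add: add_ac)
    ultimately show ?thesis by simp
  qed
  then show ?thesis using that[of H] H by blast
qed

text \<open>\<open>H\<close> has at least four elements, so it contains some \<open>w\<close>
  outside \<open>{0, v}\<close>. Translation by \<open>w\<close> commutes with the map and swaps an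
  index-two subgroup \<open>K\<close> containing \<open>v\<close> but not \<open>w\<close> with its
  complement, while the map preserves \<open>K\<close>.\<close>

lemma even_transvection:
  assumes large: "8 \<le> CARD('v)" and H: "add_subgroup (H :: 'v set)" "\<And>z w. z \<notin> H \<Longrightarrow> w \<notin> H \<Longrightarrow> z + w \<in> H" "v \<in> H"
  shows "evenperm (\<lambda>x. if x \<in> H then x else x + v)" "bij (\<lambda>x. if x \<in> H then x else x + v)"
proof -
  let ?f = "\<lambda>x. if x \<in> H then x else x + v"
  have vH: "x + v \<in> H \<longleftrightarrow> x \<in> H" for x using subgroup_add_iff[OF H(1,3)] by simp
  show "bij ?f" by (rule o_bij[of ?f]) (auto simp: fun_eq_iff vH)
  have "card (- H) \<le> card H"
  proof (cases "H = UNIV")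
    case False
    then obtain z where z: "z \<notin> H" by blast
    show ?thesis by (rule card_inj_on_le[of "\<lambda>x. x + z"]) (use H(2) z in \<open>auto simp: inj_on_def\<close>)
  qed simp
  then have "4 \<le> card H" using large by (simp add: card_Compl_finite)
  then have "\<not> H \<subseteq> {0, v}" using card_mono[of "{0, v}" H] card_length[of "[0, v]"] by auto
  then obtain w where w: "w \<in> H" "w \<noteq> 0" "w \<noteq> v" by blast
  have "add_subgroup {0, v}" by (auto simp: add_subgroup_def add_self)
  then obtain K where K: "add_subgroup K" "{0, v} \<subseteq> K" "w \<notin> K" "\<And>z w. z \<notin> K \<Longrightarrow> w \<notin> K \<Longrightarrow> z + w \<in> K"
    using index_two_subgroup_avoiding[of "{0, v}" w w] w by auto
  show "evenperm ?f"
  proof (rule evenperm_if_fibres_swapped[of ?f "\<lambda>x. x + w" "\<lambda>x. x \<in> K"])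
    show "bij ?f" by fact
    show "bij (\<lambda>x. x + w)" by (rule o_bij[of "\<lambda>x. x + w"]) (auto simp: fun_eq_iff)
    show "?f (x + w) = ?f x + w" for x using subgroup_add_iff(1)[OF H(1) w(1)] by (simp add: add.assoc add.commute[of w v])
    show "(?f x \<in> K) = (x \<in> K)" for x using subgroup_add_iff(1)[OF K(1), of v] K(2) by simp
    show "(x + w \<in> K) = (x \<notin> K)" for x
      using K(3,4) subgroup_add_iff(2)[OF K(1), of x w] by auto
  qed
qed

text \<open>Induction on the number of moved points. For a moved \<open>x\<close>, the transvection
  in direction \<open>x + f x\<close>, trivial on an index-two subgroup that contains all fixed
  points of \<open>f\<close> but neither \<open>x\<close> nor \<open>f x\<close>, sends
  \<open>f x\<close> back to \<open>x\<close>; composing with it enlarges the set of fixed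
  points.\<close>

lemma even_GL2:
  assumes large: "8 \<le> CARD('v)" and f: "(f :: 'v \<Rightarrow> 'v) \<in> GL2"
  shows "evenperm f"
  using f
proof (induction "card {x. f x \<noteq> x}" arbitrary: f rule: less_induct)
  case less
  have f: "bij f" "\<And>x y. f (x + y) = f x + f y" using less.prems by (auto simp: GL2_def)
  have f0: "f 0 = 0" using f(2)[of 0 0] add_self[of "f 0"] by simp
  show ?case
  proof (cases "f = id")
    case False
    define F where "F = {x. f x = x}"
    have F: "add_subgroup F" using f f0 by (auto simp: add_subgroup_def F_def)
    obtain x where x: "x \<notin> F" using False by (auto simp: F_def fun_eq_iff)
    define y where "y = f x"
    have y: "y \<notin> F" using x f(1) by (auto simp: F_def y_def bij_is_inj inj_eq)
    obtain H where H: "add_subgroup H" "F \<subseteq> H" "x \<notin> H" "y \<notin> H" "\<And>z w. z \<notin> H \<Longrightarrow> w \<notin> H \<Longrightarrow> z + w \<in> H"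
      using index_two_subgroup_avoiding[OF F x y] by blast
    define v where "v = x + y"
    have v: "v \<in> H" using H by (simp add: v_def)
    define t where "t z = (if z \<in> H then z else z + v)" for z
    have t_even: "evenperm t" and t_bij: "bij t"
      using even_transvection[OF large H(1,5) v] by (simp_all add: t_def[abs_def])
    have t_add: "t (a + b) = t a + t b" for a b
    proof -
      consider "a \<in> H" | "b \<in> H" | "a \<notin> H" "b \<notin> H" by blast
      then show ?thesis
      proof cases
        case 1 then show ?thesis using subgroup_add_iff(2)[OF H(1), of a b] by (simp add: t_def add_ac)
      next
        case 2 then show ?thesis using subgroup_add_iff(1)[OF H(1), of b a] by (simp add: t_def add_ac)
      next
        case 3
        then have "a + b \<in> H" by (rule H(5))
        moreover have "(a + v) + (b + v) = a + b" using cancel(2)[of "a + b" v] by (simp add: add_ac)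
        ultimately show ?thesis using 3 by (simp add: t_def)
      qed
    qed
    have "{z. (t \<circ> f) z \<noteq> z} \<subset> {z. f z \<noteq> z}"
    proof
      show "{z. (t \<circ> f) z \<noteq> z} \<subseteq> {z. f z \<noteq> z}"
      proof clarify
        fix z assume "(t \<circ> f) z \<noteq> z" "f z = z"
        moreover have "z \<in> H" using \<open>f z = z\<close> H(2) by (auto simp: F_def)
        ultimately show False by (simp add: t_def)
      qed
      have "(t \<circ> f) x = x" using H(4) by (simp add: t_def v_def y_def add.commute)
      then show "{z. (t \<circ> f) z \<noteq> z} \<noteq> {z. f z \<noteq> z}" using x by (auto simp: F_def)
    qed
    then have "card {z. (t \<circ> f) z \<noteq> z} < card {z. f z \<noteq> z}" by (intro psubset_card_mono) auto
    moreover have "t \<circ> f \<in> GL2" using t_bij t_add f by (auto simp: GL2_def bij_comp)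
    ultimately have "evenperm (t \<circ> f)" by (rule less.hyps)
    then show ?thesis using t_even t_bij f(1) by (simp add: evenperm_comp permutation_of_bij)
  qed simp
qed

end

section \<open>Walls\<close>

text \<open>With only the scalars 0 and 1, a new independent vector adds exactly one further coset
  of the span.\<close>

lemma card_span_bit:
  fixes B :: "(bit^'m::finite) set"
  assumes "finite B" "vec.independent B"
  shows "card (vec.span B) = 2 ^ card B"
  using assms
proof (induction B)
  case (insert a B)
  have ind: "vec.independent B" "a \<notin> vec.span B"
    using insert.prems insert.hyps by (simp_all add: vec.independent_insert)
  have eq: "vec.span (insert a B) = vec.span B \<union> (\<lambda>x. x + a) ` vec.span B"
  proof -
    have "x \<in> vec.span (insert a B) \<longleftrightarrow> x \<in> vec.span B \<or> x - a \<in> vec.span B" for x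
    proof -
      have "x \<in> vec.span (insert a B) \<longleftrightarrow> (\<exists>k. x - k *s a \<in> vec.span B)" by (simp add: vec.span_insert)
      also have "\<dots> \<longleftrightarrow> x - 0 *s a \<in> vec.span B \<or> x - 1 *s a \<in> vec.span B"
        by (metis (full_types) bit.exhaust)
      finally show ?thesis by simp
    qed
    moreover have "x - a \<in> vec.span B \<longleftrightarrow> x \<in> (\<lambda>x. x + a) ` vec.span B" for x
      by (auto simp: image_iff) (metis diff_add_cancel)
    ultimately show ?thesis by blast
  qed
  have disj: "vec.span B \<inter> (\<lambda>x. x + a) ` vec.span B = {}"
  proof -
    have "x + a \<notin> vec.span B" if "x \<in> vec.span B" for x
      using vec.span_diff[of "x + a" B x] that ind(2) by auto
    then show ?thesis by auto
  qed
  have "card (vec.span (insert a B)) = card (vec.span B) + card ((\<lambda>x. x + a) ` vec.span B)"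
    unfolding eq by (rule card_Un_disjoint) (use disj in auto)
  also have "card ((\<lambda>x. x + a) ` vec.span B) = card (vec.span B)" by (simp add: card_image)
  finally show ?case using insert ind by simp
qed simp

lemma card_subspace_bit:
  fixes U :: "(bit^'m::finite) set"
  assumes "vec.subspace U"
  shows "card U = 2 ^ vec.dim U"
proof -
  obtain B where B: "B \<subseteq> U" "vec.independent B" "U \<subseteq> vec.span B" "card B = vec.dim U"
    using vec.basis_exists by blast
  have "vec.span B = U" using B assms by (metis vec.span_subspace)
  then show ?thesis using card_span_bit[of B] B by simp
qed

lemma exponent_two_bit_vec: "x + x = 0" for x :: "bit^'m::finite"
  by (simp add: vec_eq_iff)

lemma exponent_two_bit_vec_vec: "x + x = 0" for x :: "(bit^'m::finite)^'n::finite"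
  by (simp add: vec_eq_iff)

interpretation bv: exponent_two "TYPE(bit^'m::finite)"
  by unfold_locales (rule exponent_two_bit_vec)

interpretation bvv: exponent_two "TYPE((bit^'m::finite)^'n::finite)"
  by unfold_locales (rule exponent_two_bit_vec_vec)

lemma subspace_iff_add_subgroup: "vec.subspace U \<longleftrightarrow> add_subgroup U" for U :: "(bit^'m::finite) set"
proof
  assume U: "add_subgroup U"
  have "c *s x \<in> U" if "x \<in> U" for c :: bit and x using U that by (cases c) (auto simp: add_subgroup_def)
  then show "vec.subspace U" using U by (auto simp: vec.subspace_def add_subgroup_def)
qed (auto simp: vec.subspace_def add_subgroup_def)

lemma card_bit_vec: "CARD(bit^'m::finite) = 2 ^ CARD('m)"
proof -
  have "(UNIV :: bit set) = {0, 1}" by auto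
  then have "CARD(bit) = 2" by (metis card_2_iff zero_neq_one)
  then show ?thesis by simp
qed

section \<open>Uniformity and anti-invariance of bricks\<close>

text \<open>Alternatives (A) and (B) read for a single brick, the form in which the derivative
  argument uses them.\<close>

definition good_brick :: "nat \<Rightarrow> (bit^'m::finite \<Rightarrow> bit^'m) \<Rightarrow> bool" where
  "good_brick r f \<longleftrightarrow> r < CARD('m) \<and>
     (1 < r \<and> diff_uniform (2 ^ r) f \<and> strongly_anti_invariant (r - 1) f \<or>
      1 \<le> r \<and> weakly_uniform (2 ^ r) f \<and> strongly_anti_invariant r f)"

text \<open>The derivative in direction \<open>u\<close> has its image in a translate of
  \<open>W\<close>, so uniformity forces \<open>W\<close> to have dimension at least
  \<open>m - r\<close>. If \<open>U\<close> were proper, anti-invariance would bound this dimension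
  from above: strictly below \<open>m - r\<close> in case (B), at most \<open>m - r\<close> in case
  (A).\<close>

lemma good_brick_derivative_covers:
  fixes f :: "bit^'m::finite \<Rightarrow> bit^'m"
  assumes good: "good_brick r f" and bij: "bij f"
    and UW: "add_subgroup U" "add_subgroup W" "f ` U = W"
    and u: "u \<noteq> 0" "\<And>e. f (e + u) + f e + f u \<in> W"
    and der: "\<And>u e. u \<in> U \<Longrightarrow> f (e + u) + f e \<in> W"
  shows "U = UNIV"
proof (rule ccontr)
  assume "U \<noteq> UNIV"
  define d where "d = vec.dim W"
  have card_W: "card W = 2 ^ d" using card_subspace_bit UW by (simp add: subspace_iff_add_subgroup d_def)
  have dim_lt: "d < CARD('m) - s" if "strongly_anti_invariant s f" for s
    using that UW \<open>U \<noteq> UNIV\<close> by (auto simp: strongly_anti_invariant_def subspace_iff_add_subgroup d_def)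
  have card_range: "card (range (fhat f u)) \<le> card W"
    by (rule card_inj_on_le[where f = "\<lambda>x. x + f u"]) (use u(2) in \<open>auto simp: inj_on_def fhat_def\<close>)
  show False
  proof (cases "1 < r \<and> diff_uniform (2 ^ r) f \<and> strongly_anti_invariant (r - 1) f")
    case True
    have uniform: "2 ^ CARD('m) \<le> card (range (fhat f v)) * 2 ^ r" if "v \<noteq> 0" for v
    proof -
      have "CARD(bit^'m) = (\<Sum>y\<in>range (fhat f v). card {x. fhat f v x = y})"
        using sum.group[of UNIV "range (fhat f v)" "fhat f v" "\<lambda>_. 1 :: nat"] by simp
      also have "\<dots> \<le> (\<Sum>y\<in>range (fhat f v). 2 ^ r)"
        using True that by (intro sum_mono) (simp add: diff_uniform_def)
      finally show ?thesis using card_bit_vec[where 'm = 'm] by simp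
    qed
    have "2 ^ CARD('m) \<le> (2 :: nat) ^ (d + r)"
    proof -
      have "2 ^ CARD('m) \<le> card (range (fhat f u)) * 2 ^ r" by (rule uniform[OF u(1)])
      also have "\<dots> \<le> 2 ^ d * 2 ^ r" using card_range card_W by simp
      finally show ?thesis by (simp only: power_add)
    qed
    then have "CARD('m) \<le> d + r" by simp
    moreover have "d < CARD('m) - (r - 1)" using dim_lt True by blast
    \<comment> \<open>In case (A) the bounds meet. The contradiction comes from a nonzero direction
      in \<open>U\<close> itself: its derivative stays in \<open>W\<close> and, \<open>f\<close>
      being injective, omits 0.\<close>
    ultimately have dr: "CARD('m) = d + r" using True by linarith
    moreover have "r < CARD('m)" using good by (simp add: good_brick_def)
    ultimately have "d > 0" by simp
    have "inj_on f U" using bij by (meson bij_is_inj inj_on_subset subset_UNIV)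
    then have "card U = card W" using card_image[of f U] UW(3) by simp
    then have "card U > 1" using card_W one_less_power[of "2 :: nat" d] \<open>d > 0\<close> by simp
    then have "\<not> U \<subseteq> {0}" using card_mono[of "{0}" U] by auto
    then obtain v where v: "v \<in> U" "v \<noteq> 0" by blast
    have "range (fhat f v) \<subseteq> W - {0}"
    proof clarify
      fix e
      have "e + v \<noteq> e" using v(2) by simp
      then have "f (e + v) \<noteq> f e" using bij by (simp add: bij_is_inj inj_eq)
      then have "fhat f v e \<noteq> 0" unfolding fhat_def using bv.add_eq_0 by blast
      then show "fhat f v e \<in> W - {0}" using der[OF v(1), of e] by (simp add: fhat_def)
    qed
    then have "card (range (fhat f v)) \<le> card (W - {0})" by (intro card_mono) auto
    also have "\<dots> < card W" using UW(2) by (intro psubset_card_mono) (auto simp: add_subgroup_def)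
    finally have "card (range (fhat f v)) * 2 ^ r < 2 ^ d * 2 ^ r" using card_W by simp
    then show False using uniform[OF v(2)] dr by (simp add: power_add)
  next
    case False
    then have weak: "weakly_uniform (2 ^ r) f" "strongly_anti_invariant r f" and r: "r < CARD('m)" "1 \<le> r"
      using good by (auto simp: good_brick_def)
    have "2 ^ (CARD('m) - 1) / real (2 ^ r) < real (card (range (fhat f u)))"
      using weak u(1) by (simp add: weakly_uniform_def)
    also have "\<dots> \<le> real (2 ^ d)" using card_range card_W by (intro of_nat_mono) simp
    finally have "2 ^ (CARD('m) - 1) < (2 :: real) ^ (d + r)" by (simp add: field_simps power_add)
    then have "CARD('m) - 1 < d + r" by simp
    then show False using dim_lt[OF weak(2)] by linarith
  qed
qed

lemma bricklayer_axis:
  assumes "\<And>j. b j 0 = 0"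
  shows "bricklayer b (axis j e) = axis j (b j e)"
  using assms by (simp add: vec_eq_iff bricklayer_nth axis_def)

text \<open>
  A bricklayer that maps the cosets of \<open>U\<close> to cosets of \<open>W\<close> puts, for each \<open>u \<in> U\<close>, the whole
  derivative of the \<open>j\<close>-th brick in direction \<open>u $ j\<close> into a translate of \<open>W \<inter> V\<^sub>j\<close>, which is too
  small for a good brick unless \<open>V\<^sub>j \<subseteq> U\<close>.
\<close>

lemma coset_mapped_subgroup_is_wall:
  fixes b :: "'n::finite \<Rightarrow> bit^'m::finite \<Rightarrow> bit^'m"
  assumes good: "\<And>j. good_brick r (b j)" and b: "\<And>j. bij (b j)" "\<And>j. b j 0 = 0"
    and UW: "add_subgroup U" "add_subgroup W" "bricklayer b ` U = W"
    and cosets: "\<And>u v. u \<in> U \<Longrightarrow> bricklayer b (v + u) + bricklayer b v \<in> W"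
  shows "\<exists>I. U = wall_of I \<and> W = U"
proof -
  define I where "I = {j. \<forall>e. axis j e \<in> U}"
  have addU: "\<And>x y. x \<in> U \<Longrightarrow> y \<in> U \<Longrightarrow> x + y \<in> U" and addW: "\<And>x y. x \<in> W \<Longrightarrow> y \<in> W \<Longrightarrow> x + y \<in> W"
    using UW by (auto simp: add_subgroup_def)
  have axis_add: "axis j (x + y) = axis j x + axis j y" for j :: 'n and x y :: "bit^'m"
    by (simp add: vec_eq_iff axis_def)
  have axis_0: "axis j 0 = 0" for j :: 'n by (simp add: vec_eq_iff axis_def)
  have inI: "j \<in> I" if "u \<in> U" "u $ j \<noteq> 0" for u j
  proof -
    define Uj where "Uj = {e. axis j e \<in> U}"
    define Wj where "Wj = {e. axis j e \<in> W}"
    have "Uj = UNIV"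
    proof (rule good_brick_derivative_covers[OF good b(1)])
      show "add_subgroup Uj" "add_subgroup Wj"
        using UW addU addW by (auto simp: add_subgroup_def Uj_def Wj_def axis_add axis_0)
      show "b j ` Uj = Wj"
      proof -
        have inj: "inj (bricklayer b)" using b(1) by (intro bij_is_inj bricklayer_bij) (simp add: bricks_ok_def)
        have "e \<in> Uj \<longleftrightarrow> b j e \<in> Wj" for e
          unfolding Uj_def Wj_def mem_Collect_eq bricklayer_axis[of b, OF b(2), symmetric] UW(3)[symmetric]
          using inj_image_mem_iff[OF inj] by blast
        moreover have "\<exists>e. y = b j e" for y using b(1)[of j] by (metis bij_pointE)
        ultimately show ?thesis by (auto simp: image_iff) metis
      qed
      show "u $ j \<noteq> 0" by fact
      show "b j (e + u $ j) + b j e + b j (u $ j) \<in> Wj" for e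
      proof -
        \<comment> \<open>Outside coordinate \<open>j\<close> the first and third terms cancel, so
          this element of \<open>W\<close> lives on that coordinate alone.\<close>
        have "bricklayer b (axis j e + u) + bricklayer b (axis j e) + bricklayer b u \<in> W"
          using cosets[OF that(1)] UW(3) that(1) addW by blast
        also have "bricklayer b (axis j e + u) + bricklayer b (axis j e) + bricklayer b u
            = axis j (b j (e + u $ j) + b j e + b j (u $ j))"
          by (auto simp: vec_eq_iff bricklayer_nth axis_def b(2))
        finally show ?thesis by (simp add: Wj_def)
      qed
      show "b j (e + u') + b j e \<in> Wj" if "u' \<in> Uj" for u' e
        using cosets[of "axis j u'" "axis j e"] that
        by (simp add: Uj_def Wj_def axis_add[symmetric] bricklayer_axis[of b, OF b(2)])
    qed
    then show ?thesis by (auto simp: I_def Uj_def)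
  qed
  have "U \<subseteq> wall_of I" using inI by (auto simp: wall_of_def)
  moreover have "wall_of I \<subseteq> U"
  proof
    fix v :: "(bit^'m)^'n" assume v: "v \<in> wall_of I"
    have "(\<Sum>j\<in>J. axis j (v $ j)) \<in> U" if "finite J" "J \<subseteq> I" for J
      using that
    proof (induction J)
      case empty then show ?case using UW by (simp add: add_subgroup_def)
    next
      case (insert j J) then show ?case using addU by (simp add: I_def)
    qed
    then have "(\<Sum>j\<in>I. axis j (v $ j)) \<in> U" by simp
    also have "(\<Sum>j\<in>I. axis j (v $ j)) = v"
    proof (subst vec_eq_iff, intro allI)
      fix k
      have "(\<Sum>j\<in>I. axis j (v $ j)) $ k = (\<Sum>j\<in>I. if k = j then v $ j else 0)"
        by (simp add: sum_component axis_def)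
      also have "\<dots> = v $ k" using v by (auto simp: wall_of_def)
      finally show "(\<Sum>j\<in>I. axis j (v $ j)) $ k = v $ k" .
    qed
    finally show "v \<in> U" .
  qed
  ultimately have U: "U = wall_of I" by blast
  \<comment> \<open>Bricks fix 0, so a wall is mapped into itself; equal sizes then give
    \<open>W = U\<close>.\<close>
  moreover have "W \<subseteq> U"
    using b(2) unfolding UW(3)[symmetric] U by (auto simp: wall_of_def bricklayer_nth)
  moreover have "card W = card U"
    unfolding UW(3)[symmetric] using b(1)
    by (intro card_image) (meson bij_is_inj bricklayer_bij bricks_ok_def inj_on_subset subset_UNIV)
  ultimately show ?thesis using card_subset_eq[of U W] by auto
qed

section \<open>Orbitals\<close>

inductive_set additive_hull :: "'a::ab_group_add set \<Rightarrow> 'a set" for S where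
  zero: "0 \<in> additive_hull S"
| add: "x \<in> additive_hull S \<Longrightarrow> s \<in> S \<Longrightarrow> x + s \<in> additive_hull S"

lemma additive_hull_subgroup: "add_subgroup (additive_hull S)"
proof -
  have "x + y \<in> additive_hull S" if "y \<in> additive_hull S" "x \<in> additive_hull S" for x y
    using that
  proof (induction y)
    case (add y s)
    then show ?case using additive_hull.add[of "x + y" S s] by (simp add: add.assoc)
  qed simp
  then show ?thesis by (auto simp: add_subgroup_def additive_hull.zero)
qed

text \<open>\<open>primitive\<close> is primitivity in additive form: as \<open>G\<close> contains
  all translations, a block through 0 is a subgroup whose cosets are permuted by
  \<open>G\<close>.\<close>

locale coordinate_group = exponent_two "TYPE('q::{finite,ab_group_add}^'n::finite)" +
  fixes G :: "('q::{finite,ab_group_add}^'n::finite \<Rightarrow> 'q::{finite,ab_group_add}^'n::finite) set" and i :: "'n::finite"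
  assumes G: "perm_group G"
    and transl_G: "\<And>v. transl v \<in> G"
    and lift_G: "\<And>g. g \<in> Alt \<Longrightarrow> lift i g \<in> G"
    and primitive: "\<And>U. add_subgroup U \<Longrightarrow> (\<And>g u v. g \<in> G \<Longrightarrow> u \<in> U \<Longrightarrow> g (v + u) + g v \<in> U) \<Longrightarrow>
      U = {0} \<or> U = UNIV"
    and q8: "8 \<le> CARD('q::{finite,ab_group_add})"
begin

definition G0 :: "('q^'n \<Rightarrow> 'q^'n) set" where
  "G0 = {h \<in> G. h 0 = 0}"

lemma G0_group: "perm_group G0"
  unfolding G0_def by (rule perm_group_stabilizer[OF G])

lemma G0_0: "h \<in> G0 \<Longrightarrow> h 0 = 0"
  by (simp add: G0_def)

lemma G0_inj: "h \<in> G0 \<Longrightarrow> h x = h y \<longleftrightarrow> x = y"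
  using perm_groupD(2)[OF G0_group] by (simp add: bij_is_inj inj_eq)

lemma G0_eq_0: "h \<in> G0 \<Longrightarrow> h x = 0 \<longleftrightarrow> x = 0"
  using G0_inj[of h x 0] by (simp add: G0_0)

lemma G0_surj: assumes "h \<in> G0" obtains x where "y = h x"
  using perm_groupD(2)[OF G0_group assms] by (metis bij_pointE)

text \<open>Moves the base point from \<open>p\<close> to 0, so that facts about the stabiliser
  apply around every point.\<close>

lemma shifted_G0:
  assumes "g \<in> G"
  shows "(\<lambda>x. g (p + x) + g p) \<in> G0"
proof -
  have "transl (g p) \<circ> (g \<circ> transl p) \<in> G" using assms G transl_G by (intro perm_groupD(4))
  then show ?thesis by (simp add: G0_def transl_def comp_def add.commute add_self)
qed

lemma G0_sub: "h \<in> G0 \<Longrightarrow> h \<in> G"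
  by (simp add: G0_def)

text \<open>Since translations belong to \<open>G\<close>, \<open>orb (x + y)\<close> labels the
  orbital of the pair \<open>(x, y)\<close>.\<close>

definition orb :: "'q^'n \<Rightarrow> ('q^'n) set" where
  "orb v = {h v | h. h \<in> G0}"

lemma orb_self: "v \<in> orb v"
  using perm_groupD(1)[OF G0_group] by (auto simp: orb_def intro!: exI[of _ id])

lemma orb_image: assumes "h \<in> G0" shows "orb (h v) = orb v"
proof -
  have "orb (h v) \<subseteq> orb v" if "h \<in> G0" for h v
    using perm_groupD(4)[OF G0_group _ that] by (auto simp: orb_def) (metis comp_apply)
  from this[OF assms, of v] this[OF perm_groupD(3)[OF G0_group assms], of "h v"]
  show ?thesis using perm_groupD(2)[OF G0_group assms] by (simp add: bij_is_inj)
qed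

lemma orb_memD: "u \<in> orb v \<Longrightarrow> \<exists>h\<in>G0. u = h v"
  by (auto simp: orb_def)

lemma orb_eq_iff: "orb u = orb v \<longleftrightarrow> u \<in> orb v"
  using orb_self orb_image orb_memD by metis

lemma orb_diff:
  assumes "h \<in> G0"
  shows "orb (h u + h v) = orb (u + v)"
  using orb_image[OF shifted_G0[OF G0_sub[OF assms], of u], of "u + v"] by (simp add: add.commute)

text \<open>The number of points lying in different orbitals with 0 and with
  \<open>v\<close>.\<close>

definition dist_count :: "'q^'n \<Rightarrow> nat" where
  "dist_count v = card {w. orb w \<noteq> orb (w + v)}"

lemma dist_count_image:
  assumes h: "h \<in> G0"
  shows "dist_count (h v) = dist_count v"
proof -
  have "h ` {w. orb w \<noteq> orb (w + v)} = {w. orb w \<noteq> orb (w + h v)}"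
  proof (intro equalityI subsetI)
    fix w assume "w \<in> h ` {w. orb w \<noteq> orb (w + v)}"
    then show "w \<in> {w. orb w \<noteq> orb (w + h v)}" using orb_image[OF h] orb_diff[OF h] by auto
  next
    fix w assume w: "w \<in> {w. orb w \<noteq> orb (w + h v)}"
    obtain x where x: "w = h x" by (rule G0_surj[OF h])
    show "w \<in> h ` {w. orb w \<noteq> orb (w + v)}" using w orb_image[OF h] orb_diff[OF h] by (auto simp: x)
  qed
  moreover have "card (h ` {w. orb w \<noteq> orb (w + v)}) = card {w. orb w \<noteq> orb (w + v)}"
    by (rule card_image) (simp add: inj_on_def G0_inj[OF h])
  ultimately show ?thesis by (simp add: dist_count_def)
qed

lemma dist_count_orb: "orb u = orb v \<Longrightarrow> dist_count u = dist_count v"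
  using dist_count_image orb_eq_iff orb_memD by metis

section \<open>Slicing along the distinguished coordinate\<close>

abbreviation ax :: "'q \<Rightarrow> 'q^'n" where "ax \<equiv> axis i"

definition F :: "('q^'n) set" where
  "F = {v. v $ i = 0}"

text \<open>Projection onto \<open>F\<close> along the \<open>i\<close>-th summand; adding the
  component cancels it.\<close>

definition pr :: "'q^'n \<Rightarrow> 'q^'n" where
  "pr v = v + ax (v $ i)"

lemma add_self_q: "e + e = 0" for e :: 'q
proof -
  have "(ax e + ax e) $ i = 0" by (simp add: add_self)
  then show ?thesis by (simp add: axis_def)
qed

lemma q_add_eq_0: "e + e' = 0 \<longleftrightarrow> e = e'" for e e' :: 'q
  by (metis add_self_q add_left_cancel)

lemma ax_nth: "ax e $ i = e"
  by (simp add: axis_def)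

lemma ax_add: "ax (e + e') = ax e + ax e'"
  by (simp add: vec_eq_iff axis_def)

lemma ax_0: "ax 0 = 0"
  by (simp add: vec_eq_iff axis_def)

lemma pr_add: "pr (u + v) = pr u + pr v"
  by (simp add: pr_def ax_add add_ac)

lemma pr_ax: "pr (ax e) = 0"
  by (simp add: pr_def ax_nth add_self)

lemma pr_F: "pr v \<in> F" and F_pr: "f \<in> F \<Longrightarrow> pr f = f"
  by (simp_all add: pr_def F_def ax_nth add_self_q ax_0)

lemma split_pr: "v = ax (v $ i) + pr v"
  by (simp add: pr_def)

lemma F_add: "f \<in> F \<Longrightarrow> g \<in> F \<Longrightarrow> f + g \<in> F" and F_0: "0 \<in> F"
  by (simp_all add: F_def)

text \<open>A three-cycle on the \<open>i\<close>-th coordinate that avoids 0 changes one nonzero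
  label into any other.\<close>

lemma orb_label:
  assumes "v $ i \<noteq> 0" "v $ i + e \<noteq> 0"
  shows "orb (v + ax e) = orb v"
proof (cases "e = 0")
  case False
  define a where "a = v $ i"
  define a' where "a' = a + e"
  have "card {0, a, a'} < CARD('q)" using q8 card_length[of "[0, a, a']"] by auto
  then obtain d where d: "d \<notin> {0, a, a'}" by (metis UNIV_eq_I less_irrefl)
  have aa': "a \<noteq> a'" "a \<noteq> 0" "a' \<noteq> 0" using False assms by (auto simp: a_def a'_def)
  have h: "lift i (cyc3 a a' d) \<in> G0"
    using lift_G[of "cyc3 a a' d"] cyc3_in_Alt[of a a' d] aa' d
    by (auto simp: G0_def vec_eq_iff lift_nth cyc3_apply)
  moreover have "lift i (cyc3 a a' d) v = v + ax e"
    using aa' d by (auto simp: vec_eq_iff lift_nth cyc3_apply a_def[symmetric] axis_def) (simp add: a'_def a_def)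
  ultimately show ?thesis using orb_image[OF h, of v] by simp
qed (simp add: ax_0)

definition e0 :: 'q where
  "e0 = (SOME e. e \<noteq> 0)"

lemma e0: "e0 \<noteq> 0"
proof -
  have "card {0 :: 'q} < CARD('q)" using q8 by simp
  then have "\<exists>e :: 'q. e \<noteq> 0" by (metis UNIV_eq_I less_irrefl singletonI)
  then show ?thesis unfolding e0_def by (rule someI_ex)
qed

text \<open>By \<open>orb_label\<close> this is the common orbit of all points over
  \<open>f \<in> F\<close> with nonzero label; \<open>e0\<close> is a mere representative.\<close>

definition kap :: "'q^'n \<Rightarrow> ('q^'n) set" where
  "kap f = orb (ax e0 + f)"

lemma orb_kap:
  assumes "f \<in> F" "e \<noteq> 0"
  shows "orb (ax e + f) = kap f"
proof -
  have "orb (ax e0 + f + ax (e0 + e)) = orb (ax e0 + f)"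
    using assms e0 add_self_q[of e0] by (intro orb_label) (auto simp: F_def ax_nth add.assoc[symmetric])
  moreover have "ax e0 + f + ax (e0 + e) = ax e + f"
    using cancel(1)[of "ax e0" "f + ax e"] by (simp add: ax_add add_ac)
  ultimately show ?thesis by (simp add: kap_def)
qed

lemma orb_kap_pr: "v $ i \<noteq> 0 \<Longrightarrow> orb v = kap (pr v)"
  using orb_kap[OF pr_F, of "v $ i" v] split_pr[of v] by simp

lemma card_slices: "card {w. P w} = (\<Sum>a\<in>UNIV. card {f \<in> F. P (ax a + f)})"
proof -
  have "card {w. P w} = (\<Sum>w | P w. 1)" by simp
  also have "\<dots> = (\<Sum>a\<in>UNIV. \<Sum>w | w \<in> {w. P w} \<and> w $ i = a. 1)"
    by (rule sum.group[symmetric]) auto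
  also have "\<dots> = (\<Sum>a\<in>UNIV. card {f \<in> F. P (ax a + f)})"
  proof (rule sum.cong)
    fix a
    have "{w. w \<in> {w. P w} \<and> w $ i = a} = (\<lambda>f. ax a + f) ` {f \<in> F. P (ax a + f)}"
    proof (intro equalityI subsetI)
      fix w assume "w \<in> {w. w \<in> {w. P w} \<and> w $ i = a}"
      then show "w \<in> (\<lambda>f. ax a + f) ` {f \<in> F. P (ax a + f)}"
        using split_pr[of w] pr_F[of w] by (intro image_eqI[of _ _ "pr w"]) auto
    qed (auto simp: F_def ax_nth)
    then show "(\<Sum>w | w \<in> {w. P w} \<and> w $ i = a. 1) = card {f \<in> F. P (ax a + f)}"
      by (simp add: card_image inj_on_def)
  qed simp
  finally show ?thesis .
qed

lemma card_F_shift: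
  assumes "f \<in> F"
  shows "card {g \<in> F. P (g + f)} = card {g \<in> F. P g}"
proof -
  have "(\<lambda>g. g + f) ` {g \<in> F. P (g + f)} = {g \<in> F. P g}"
  proof (intro equalityI subsetI)
    fix g assume "g \<in> {g \<in> F. P g}"
    then show "g \<in> (\<lambda>g. g + f) ` {g \<in> F. P (g + f)}"
      using F_add[OF _ assms] by (intro image_eqI[of _ _ "g + f"]) auto
  qed (use F_add[OF _ assms] in auto)
  moreover have "card ((\<lambda>g. g + f) ` {g \<in> F. P (g + f)}) = card {g \<in> F. P (g + f)}"
    by (rule card_image) (simp add: inj_on_def)
  ultimately show ?thesis by simp
qed

definition s_count :: "'q^'n \<Rightarrow> nat" where
  "s_count f = card {g \<in> F. kap g \<noteq> kap (g + f)}"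

definition r_count :: "'q^'n \<Rightarrow> nat" where
  "r_count f = card {g \<in> F. orb g \<noteq> kap (g + f)}"

text \<open>In the slices with labels 0 and \<open>e\<close> one of the two compared points lies in
  \<open>F\<close>, giving \<open>r_count\<close>. In the other slices both labels are nonzero,
  giving \<open>s_count\<close>.\<close>

lemma dist_count_off_F:
  assumes f: "f \<in> F" and e: "e \<noteq> 0"
  shows "dist_count (ax e + f) = 2 * r_count f + (CARD('q) - 2) * s_count f"
proof -
  have "dist_count (ax e + f) = (\<Sum>a\<in>UNIV. card {g \<in> F. orb (ax a + g) \<noteq> orb (ax a + g + (ax e + f))})"
    unfolding dist_count_def by (rule card_slices)
  also have "\<dots> = (\<Sum>a\<in>UNIV. if a = 0 \<or> a = e then r_count f else s_count f)"
  proof (rule sum.cong)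
    fix a :: 'q
    have shift: "ax a + g + (ax e + f) = ax (a + e) + (g + f)" for g by (simp add: ax_add add_ac)
    have gf: "g + f \<in> F" if "g \<in> F" for g using F_add[OF that f] .
    consider "a = 0" | "a = e" "a \<noteq> 0" | "a \<noteq> 0" "a \<noteq> e" by blast
    then show "card {g \<in> F. orb (ax a + g) \<noteq> orb (ax a + g + (ax e + f))} = (if a = 0 \<or> a = e then r_count f else s_count f)"
    proof cases
      case 1
      have "orb (ax a + g) = orb g" "orb (ax a + g + (ax e + f)) = kap (g + f)" if "g \<in> F" for g
        unfolding shift using 1 orb_kap[OF gf[OF that] e] by (simp_all add: ax_0)
      then have "{g \<in> F. orb (ax a + g) \<noteq> orb (ax a + g + (ax e + f))} = {g \<in> F. orb g \<noteq> kap (g + f)}"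
        by auto
      then show ?thesis using 1 by (simp add: r_count_def)
    next
      case 2
      have "orb (ax a + g) = kap (g + f + f)" "orb (ax a + g + (ax e + f)) = orb (g + f)" if "g \<in> F" for g
        unfolding shift using 2 orb_kap[OF that e] by (simp_all add: ax_0 add_self_q)
      then have "{g \<in> F. orb (ax a + g) \<noteq> orb (ax a + g + (ax e + f))} = {g \<in> F. orb (g + f) \<noteq> kap (g + f + f)}"
        by auto
      then show ?thesis using 2 card_F_shift[OF f, of "\<lambda>g. orb g \<noteq> kap (g + f)"] by (simp add: r_count_def)
    next
      case 3
      then have "a + e \<noteq> 0" by (simp add: q_add_eq_0)
      then have "orb (ax a + g) = kap g" "orb (ax a + g + (ax e + f)) = kap (g + f)" if "g \<in> F" for g
        unfolding shift using orb_kap[OF that 3(1)] orb_kap[OF gf[OF that]] by simp_all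
      then have "{g \<in> F. orb (ax a + g) \<noteq> orb (ax a + g + (ax e + f))} = {g \<in> F. kap g \<noteq> kap (g + f)}"
        by auto
      then show ?thesis using 3 by (simp add: s_count_def)
    qed
  qed simp
  also have "\<dots> = (\<Sum>a\<in>{0, e}. r_count f) + (\<Sum>a\<in>- {0, e}. s_count f)"
  proof -
    have "{a. a = 0 \<or> a = e} = {0, e}" by auto
    then show ?thesis by (simp only: sum.If_cases[OF finite] Int_UNIV_left)
  qed
  also have "card {0, e} = 2" using e by auto
  then have "(\<Sum>a\<in>{0, e}. r_count f) + (\<Sum>a\<in>- {0, e}. s_count f) = 2 * r_count f + (CARD('q) - 2) * s_count f"
    by (simp only: sum_constant card_Compl_finite of_nat_id)
  finally show ?thesis .
qed

lemma dist_count_F: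
  assumes f: "f \<in> F"
  shows "dist_count f = card {g \<in> F. orb g \<noteq> orb (g + f)} + (CARD('q) - 1) * s_count f"
proof -
  have "dist_count f = (\<Sum>a\<in>UNIV. card {g \<in> F. orb (ax a + g) \<noteq> orb (ax a + g + f)})"
    unfolding dist_count_def by (rule card_slices)
  also have "\<dots> = card {g \<in> F. orb (ax 0 + g) \<noteq> orb (ax 0 + g + f)}
      + (\<Sum>a\<in>UNIV - {0}. card {g \<in> F. orb (ax a + g) \<noteq> orb (ax a + g + f)})"
    by (rule sum.remove) auto
  also have "(\<Sum>a\<in>UNIV - {0}. card {g \<in> F. orb (ax a + g) \<noteq> orb (ax a + g + f)}) = (\<Sum>a\<in>UNIV - {0 :: 'q}. s_count f)"
  proof (rule sum.cong)
    fix a :: 'q assume a: "a \<in> UNIV - {0}"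
    then have "{g \<in> F. orb (ax a + g) \<noteq> orb (ax a + g + f)} = {g \<in> F. kap g \<noteq> kap (g + f)}"
      using orb_kap[OF _, of _ a] F_add[OF _ f] by (auto simp: add.assoc)
    then show "card {g \<in> F. orb (ax a + g) \<noteq> orb (ax a + g + f)} = s_count f" by (simp add: s_count_def)
  qed simp
  finally show ?thesis by (simp add: ax_0)
qed

text \<open>Counts the points of \<open>F\<close> whose orbit differs from that of the points above
  them with nonzero label.\<close>

definition \<delta> :: nat where
  "\<delta> = r_count 0"

lemma delta_le: "\<delta> \<le> r_count f + s_count f"
proof -
  have "{g \<in> F. orb g \<noteq> kap (g + 0)} \<subseteq> {g \<in> F. orb g \<noteq> kap (g + f)} \<union> {g \<in> F. kap g \<noteq> kap (g + f)}" by auto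
  then have "\<delta> \<le> card ({g \<in> F. orb g \<noteq> kap (g + f)} \<union> {g \<in> F. kap g \<noteq> kap (g + f)})"
    unfolding \<delta>_def r_count_def by (intro card_mono) auto
  also have "\<dots> \<le> r_count f + s_count f" unfolding r_count_def s_count_def by (rule card_Un_le)
  finally show ?thesis .
qed

text \<open>\<open>delta_le\<close> costs at most \<open>2 * s_count f\<close>, while at least six
  slices contribute \<open>s_count f\<close> each.\<close>

lemma dist_count_off_F_ge:
  assumes "f \<in> F" "e \<noteq> 0"
  shows "2 * \<delta> + 4 * s_count f \<le> dist_count (ax e + f)"
proof -
  have "6 * s_count f \<le> (CARD('q) - 2) * s_count f" using q8 by (intro mult_right_mono) auto
  then show ?thesis using dist_count_off_F[OF assms] delta_le[of f] by linarith
qed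

text \<open>Along a sum, \<open>h (x + s)\<close> differs from \<open>h x\<close> by the image of
  \<open>s\<close> under a shifted element, which is again in \<open>S\<close>. So the cosets of the
  hull are permuted and primitivity applies.\<close>

lemma hull_UNIV:
  assumes S: "\<And>h s. h \<in> G0 \<Longrightarrow> s \<in> S \<Longrightarrow> h s \<in> S" and "s \<in> S" "s \<noteq> 0"
  shows "additive_hull S = UNIV"
proof -
  have inv: "h x \<in> additive_hull S" if "x \<in> additive_hull S" "h \<in> G0" for h x
    using that
  proof (induction x)
    case zero then show ?case by (simp add: G0_0 additive_hull.zero)
  next
    case (add x s)
    have "h (x + s) + h x \<in> S" using S[OF shifted_G0[OF G0_sub[OF add.prems], of x] add.hyps(2)] .
    then have "h x + (h (x + s) + h x) \<in> additive_hull S" using add by (intro additive_hull.add) auto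
    then show ?case by (simp add: add.commute)
  qed
  have "additive_hull S = {0} \<or> additive_hull S = UNIV"
  proof (rule primitive[OF additive_hull_subgroup])
    fix g u v assume "g \<in> G" "u \<in> additive_hull S"
    then show "g (v + u) + g v \<in> additive_hull S" using inv[OF _ shifted_G0, of u g v] by simp
  qed
  moreover have "s \<in> additive_hull S" using additive_hull.add[OF additive_hull.zero assms(2)] by simp
  ultimately show ?thesis using assms(3) by blast
qed

text \<open>An orbit inside \<open>F\<close> would generate only a subgroup of \<open>F\<close>,
  against \<open>hull_UNIV\<close>.\<close>

lemma orb_leaves_F:
  assumes "v \<noteq> 0"
  shows "\<exists>h\<in>G0. h v $ i \<noteq> 0"
proof (rule ccontr)
  assume "\<not> ?thesis"
  then have sub: "orb v \<subseteq> F" by (auto simp: orb_def F_def)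
  have "h s \<in> orb v" if "h \<in> G0" "s \<in> orb v" for h s
    using orb_image[OF that(1), of s] that(2) orb_self[of "h s"] orb_eq_iff[of s v] by simp
  then have "additive_hull (orb v) = UNIV" using orb_self assms by (intro hull_UNIV[of "orb v" v]) auto
  moreover have "x \<in> F" if "x \<in> additive_hull (orb v)" for x
    using that by induction (use sub F_add F_0 in auto)
  ultimately have "ax e0 \<in> F" by blast
  then show False using e0 by (simp add: F_def ax_nth)
qed

section \<open>The orbital of least distance and its lines\<close>

definition c1 :: "('q^'n) set" where
  "c1 = orb (ax e0)"

lemma kap_0: "kap 0 = c1"
  by (simp add: kap_def c1_def)

lemma c1_iff: "v \<in> c1 \<longleftrightarrow> orb v = c1"
  by (simp add: c1_def orb_eq_iff)

lemma s_count_0: "f \<in> F \<Longrightarrow> s_count f = 0 \<Longrightarrow> g \<in> F \<Longrightarrow> kap (g + f) = kap g"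
  by (auto simp: s_count_def)

lemma dist_count_c1: "v \<in> c1 \<Longrightarrow> dist_count v = 2 * \<delta>"
  using dist_count_orb[of v "ax e0"] orb_eq_iff[of v "ax e0"] dist_count_off_F[OF F_0 e0]
  by (simp add: c1_def s_count_def \<delta>_def)

text \<open>Some image of \<open>v\<close> lies off \<open>F\<close> and has the same count.
  Minimality forces its \<open>s_count\<close> to vanish, so its \<open>kap\<close> agrees with
  \<open>kap 0\<close>.\<close>

lemma dist_count_min:
  assumes v: "v \<noteq> 0" "dist_count v \<le> 2 * \<delta>"
  shows "v \<in> c1"
proof -
  obtain h where h: "h \<in> G0" "h v $ i \<noteq> 0" using orb_leaves_F[OF v(1)] by blast
  define f where "f = pr (h v)"
  have f: "f \<in> F" by (simp add: f_def pr_F)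
  have "2 * \<delta> + 4 * s_count f \<le> dist_count (h v)"
    using dist_count_off_F_ge[OF f h(2)] split_pr[of "h v"] by (simp add: f_def)
  then have "s_count f = 0" using dist_count_image[OF h(1)] v(2) by simp
  then have "kap f = c1" using s_count_0[OF f _ F_0] kap_0 by simp
  then have "orb (h v) = c1" using orb_kap_pr[OF h(2)] by (simp add: f_def)
  then show ?thesis using orb_image[OF h(1)] by (simp add: c1_iff)
qed

definition Y :: "('q^'n) set" where
  "Y = {f \<in> F. kap f = c1}"

lemma Y_s_count:
  assumes "f \<in> Y" shows "s_count f = 0"
proof -
  have f: "f \<in> F" "kap f = c1" using assms by (auto simp: Y_def)
  then have "ax e0 + f \<in> c1" using c1_iff by (simp add: kap_def)
  then show ?thesis using dist_count_c1 dist_count_off_F_ge[OF f(1) e0] by fastforce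
qed

lemma Y_subgroup: "add_subgroup Y"
  using s_count_0[OF _ Y_s_count] F_0 F_add by (auto simp: add_subgroup_def Y_def kap_0)

text \<open>Translation by \<open>f\<close> preserves \<open>kap\<close>, so passing from
  \<open>orb g\<close> to \<open>orb (g + f)\<close> through this common value costs at most
  \<open>2 * \<delta>\<close>.\<close>

lemma Y_c1:
  assumes "f \<in> Y" "f \<noteq> 0" shows "f \<in> c1"
proof (rule dist_count_min[OF assms(2)])
  have f: "f \<in> F" using assms by (simp add: Y_def)
  have inv: "kap (g + f) = kap g" if "g \<in> F" for g using s_count_0[OF f Y_s_count[OF assms(1)] that] .
  have "{g \<in> F. orb g \<noteq> orb (g + f)} \<subseteq> {g \<in> F. orb g \<noteq> kap g} \<union> {g \<in> F. orb (g + f) \<noteq> kap (g + f)}"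
    using inv by auto
  then have "card {g \<in> F. orb g \<noteq> orb (g + f)} \<le> card ({g \<in> F. orb g \<noteq> kap g} \<union> {g \<in> F. orb (g + f) \<noteq> kap (g + f)})"
    by (intro card_mono) auto
  also have "\<dots> \<le> card {g \<in> F. orb g \<noteq> kap g} + card {g \<in> F. orb (g + f) \<noteq> kap (g + f)}" by (rule card_Un_le)
  also have "\<dots> = 2 * \<delta>" using card_F_shift[OF f, of "\<lambda>g. orb g \<noteq> kap g"] by (simp add: \<delta>_def r_count_def)
  finally show "dist_count f \<le> 2 * \<delta>" using dist_count_F[OF f] Y_s_count[OF assms(1)] by simp
qed

text \<open>The closed neighbourhood of 0 in the graph of the orbital \<open>c1\<close>.\<close>

definition \<Lambda> :: "('q^'n) set" where
  "\<Lambda> = insert 0 c1"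

text \<open>The sum of the \<open>i\<close>-th summand and \<open>Y\<close>; it turns out to be the
  line through \<open>ax e0\<close>.\<close>

definition line0 :: "('q^'n) set" where
  "line0 = {v. pr v \<in> Y}"

text \<open>For \<open>a \<in> c1\<close>, the points equal or adjacent to 0 and also equal or
  adjacent to \<open>a\<close>.\<close>

definition line :: "'q^'n \<Rightarrow> ('q^'n) set" where
  "line a = {z \<in> \<Lambda>. z + a \<in> \<Lambda>}"

lemma line0_subgroup: "add_subgroup line0"
  using Y_subgroup F_pr[OF F_0] by (auto simp: add_subgroup_def line0_def pr_add)

lemma line0_sub: "line0 \<subseteq> \<Lambda>"
proof
  fix v assume v: "v \<in> line0"
  show "v \<in> \<Lambda>"
  proof (cases "v $ i = 0")
    case True
    then have "v \<in> Y" using v F_pr[of v] by (simp add: line0_def F_def)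
    then show ?thesis using Y_c1 by (auto simp: \<Lambda>_def)
  next
    case False
    then have "orb v = c1" using orb_kap_pr[OF False] v by (simp add: line0_def Y_def)
    then show ?thesis by (simp add: \<Lambda>_def c1_iff)
  qed
qed

lemma \<Lambda>_line0:
  assumes "v \<in> \<Lambda>" "v $ i \<noteq> 0" shows "v \<in> line0"
proof -
  have "v \<in> c1" using assms by (auto simp: \<Lambda>_def)
  then show ?thesis using orb_kap_pr[OF assms(2)] pr_F by (simp add: c1_iff line0_def Y_def)
qed

lemma \<Lambda>_iff: "v \<in> \<Lambda> \<longleftrightarrow> v = 0 \<or> orb v = c1"
  by (simp add: \<Lambda>_def c1_iff)

lemma line0_line_subset: "y \<in> line0 \<Longrightarrow> line0 \<subseteq> line y"
  using line0_subgroup line0_sub by (auto simp: line_def add_subgroup_def)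

lemma line_off_F:
  assumes y: "y \<in> line0" "y $ i \<noteq> 0" shows "line y = line0"
proof
  show "line y \<subseteq> line0"
  proof
    fix z assume "z \<in> line y"
    then have z: "z \<in> \<Lambda>" "z + y \<in> \<Lambda>" by (auto simp: line_def)
    show "z \<in> line0"
    proof (cases "z $ i = 0")
      case True
      then have "z + y \<in> line0" using z y by (intro \<Lambda>_line0) auto
      then show ?thesis using subgroup_add_iff(1)[OF line0_subgroup y(1)] by simp
    qed (use z \<Lambda>_line0 in auto)
  qed
qed (rule line0_line_subset[OF y(1)])

lemma ax_line0: "ax e \<in> line0"
  using Y_subgroup by (simp add: line0_def pr_ax add_subgroup_def)

lemma line_ax: "line (ax e0) = line0"
  using line_off_F[OF ax_line0] e0 by (simp add: ax_nth)

lemma line_image: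
  assumes h: "h \<in> G0" shows "h ` line a = line (h a)"
proof -
  have *: "h z \<in> \<Lambda> \<longleftrightarrow> z \<in> \<Lambda>" "h z + h a \<in> \<Lambda> \<longleftrightarrow> z + a \<in> \<Lambda>" for z
    using orb_image[OF h] orb_diff[OF h] G0_eq_0[OF h] G0_inj[OF h] by (simp_all add: \<Lambda>_iff)
  show ?thesis
  proof (intro equalityI subsetI)
    fix z assume z: "z \<in> line (h a)"
    obtain x where x: "z = h x" by (rule G0_surj[OF h])
    show "z \<in> h ` line a" using z * by (auto simp: x line_def)
  qed (use * in \<open>auto simp: line_def\<close>)
qed

lemma card_line_image: "h \<in> G0 \<Longrightarrow> card (line (h a)) = card (line a)"
  using card_image[of h "line a"] G0_inj by (simp add: line_image[symmetric] inj_on_def)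

lemma c1_image: "h \<in> G0 \<Longrightarrow> h v \<in> c1 \<longleftrightarrow> v \<in> c1"
  by (simp add: c1_iff orb_image)

lemma ax_c1: "ax e0 \<in> c1"
  by (simp add: c1_def orb_self)

lemma c1_ne_0: "0 \<notin> c1"
  using orb_memD[of 0 "ax e0"] G0_eq_0[of _ "ax e0"] e0 ax_nth[of e0] by (auto simp: c1_def)

lemma c1_E: assumes "a \<in> c1" obtains h where "h \<in> G0" "a = h (ax e0)"
  using assms orb_memD by (auto simp: c1_def)

text \<open>One inclusion is known, and all lines through points of \<open>c1\<close> are conjugate
  and so of equal size.\<close>

lemma line_line0:
  assumes y: "y \<in> line0" "y \<noteq> 0" shows "line y = line0"
proof -
  have "y \<in> c1" using y line0_sub by (auto simp: \<Lambda>_def)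
  then obtain h where "h \<in> G0" "y = h (ax e0)" by (rule c1_E)
  then have "card (line y) = card line0" using card_line_image by (simp add: line_ax)
  then show ?thesis using card_subset_eq[OF finite line0_line_subset[OF y(1)]] by simp
qed

lemma line_eq:
  assumes a: "a \<in> c1" "b \<in> line a" "b \<noteq> 0" shows "line b = line a"
proof -
  obtain h where h: "h \<in> G0" "a = h (ax e0)" using c1_E[OF a(1)] by blast
  then have la: "line a = h ` line0" by (simp add: line_image[symmetric] line_ax)
  then obtain b0 where b0: "b0 \<in> line0" "b = h b0" using a by auto
  then have "b0 \<noteq> 0" using a(3) h(1) by (auto simp: G0_0)
  then show ?thesis using line_line0[OF b0(1)] by (simp add: la b0(2) line_image[OF h(1), symmetric])
qed

lemma line_self: "a \<in> c1 \<Longrightarrow> a \<in> line a"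
  by (simp add: line_def \<Lambda>_def add_self)

text \<open>For a nonzero \<open>x\<close> on the line, \<open>line x\<close> is the same line, and
  membership in \<open>line x\<close> is invariant under adding \<open>x\<close>.\<close>

lemma line_subgroup:
  assumes a: "a \<in> c1" shows "add_subgroup (line a)"
proof -
  have z: "0 \<in> line a" using a by (simp add: line_def \<Lambda>_def)
  have "x + y \<in> line a" if x: "x \<in> line a" and y: "y \<in> line a" for x y
  proof (cases "x = 0")
    case False
    have "y \<in> line x" using y line_eq[OF a x False] by simp
    moreover have "x \<in> \<Lambda>" using x by (simp add: line_def)
    ultimately have "y + x \<in> line x" by (simp add: line_def)
    then show ?thesis using line_eq[OF a x False] by (simp add: add.commute)
  qed (use y in simp)
  then show ?thesis using z by (simp add: add_subgroup_def)
qed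

text \<open>\<open>v\<close> must lie in \<open>F\<close>, so one of \<open>z + ax e0\<close>,
  \<open>z + v\<close> lies off \<open>F\<close> and therefore in \<open>line0\<close>. A nonzero
  \<open>y \<in> line0\<close> with \<open>v + y \<in> \<Lambda>\<close> would put \<open>v\<close>
  on \<open>line0\<close>.\<close>

lemma common_neighbours_ax:
  assumes v: "v \<in> c1" "v \<notin> line0" and z: "z + ax e0 \<in> c1" "z + v \<in> c1"
  shows "z = 0 \<or> z = ax e0 + v"
proof -
  have \<Lambda>: "v \<in> \<Lambda>" "z + ax e0 \<in> \<Lambda>" "z + v \<in> \<Lambda>" using v z by (auto simp: \<Lambda>_def)
  have vi: "v $ i = 0" using \<Lambda>_line0[OF \<Lambda>(1)] v(2) by blast
  have key: "y = 0" if "y \<in> line0" "v + y \<in> \<Lambda>" for y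
  proof (rule ccontr)
    assume "y \<noteq> 0"
    then have "v \<in> line y" using that \<Lambda>(1) by (simp add: line_def)
    then show False using line_line0[OF that(1) \<open>y \<noteq> 0\<close>] v(2) by simp
  qed
  show ?thesis
  proof (cases "z $ i = 0")
    case True
    then have "z + ax e0 \<in> line0" using e0 by (intro \<Lambda>_line0[OF \<Lambda>(2)]) (simp add: ax_nth)
    then have "z \<in> line0" using subgroup_add_iff(1)[OF line0_subgroup ax_line0] by simp
    then show ?thesis using key[of z] \<Lambda>(3) by (simp add: add.commute)
  next
    case False
    then have "z + v \<in> line0" using vi by (intro \<Lambda>_line0[OF \<Lambda>(3)]) simp
    then have "z + v + ax e0 \<in> line0" using subgroup_add_iff(1)[OF line0_subgroup ax_line0] by simp
    moreover have eq: "v + (z + v + ax e0) = z + ax e0" using cancel(1)[of v "z + ax e0"] by (simp add: add_ac)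
    moreover have "v + (z + v + ax e0) \<in> \<Lambda>" unfolding eq by (rule \<Lambda>(2))
    ultimately have "z + v + ax e0 = 0" using key by blast
    then have "z + v = ax e0" by simp
    then have "z = ax e0 + v" by (metis cancel(2))
    then show ?thesis by simp
  qed
qed

lemma common_neighbours:
  assumes a: "a \<in> c1" and v: "v \<in> c1" "v \<notin> line a" and z: "z + a \<in> c1" "z + v \<in> c1" "z \<noteq> 0"
  shows "z = a + v"
proof -
  obtain k where k: "k \<in> G0" "a = k (ax e0)" using c1_E[OF a] by blast
  have la: "line a = k ` line0" using k by (simp add: line_image[symmetric] line_ax)
  obtain v0 where v0: "v = k v0" by (rule G0_surj[OF k(1)])
  have v0c: "v0 \<in> c1" "v0 \<notin> line0" using v c1_image[OF k(1)] by (auto simp: v0 la)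
  have uniq: "z = k (ax e0 + v0)" if "z + a \<in> c1" "z + v \<in> c1" "z \<noteq> 0" for z
  proof -
    obtain z0 where z0: "z = k z0" by (rule G0_surj[OF k(1)])
    have "z0 + ax e0 \<in> c1" "z0 + v0 \<in> c1"
      using that orb_diff[OF k(1)] by (simp_all add: c1_iff z0 k(2) v0)
    moreover have "z0 \<noteq> 0" using that(3) k(1) by (auto simp: z0 G0_0)
    ultimately show ?thesis using common_neighbours_ax[OF v0c] z0 by blast
  qed
  have "a \<noteq> v" using v(2) line_self[OF a] by blast
  then have "a + v = k (ax e0 + v0)" using a v(1) by (intro uniq) (auto simp: add.commute)
  then show ?thesis using uniq[OF z] by simp
qed

text \<open>The points 0, \<open>a\<close>, \<open>a + v\<close>, \<open>v\<close> form a
  quadrangle. Its image is again one, and \<open>common_neighbours\<close> says that three vertices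
  determine the fourth.\<close>

lemma additive_on_lines:
  assumes h: "h \<in> G0" and a: "a \<in> c1" and v: "v \<in> c1" "v \<notin> line a"
  shows "h (a + v) = h a + h v"
proof (rule common_neighbours)
  show "h a \<in> c1" "h v \<in> c1" using a v(1) c1_image[OF h] by auto
  show "h v \<notin> line (h a)" using v(2) G0_inj[OF h] by (auto simp: line_image[OF h, symmetric])
  show "h (a + v) + h a \<in> c1" "h (a + v) + h v \<in> c1"
    using a v(1) orb_diff[OF h] by (simp_all add: c1_iff)
  have "a \<noteq> v" using v(2) line_self[OF a] by blast
  then show "h (a + v) \<noteq> 0" using G0_eq_0[OF h] by simp
qed

lemma line_shift_c1:
  assumes k: "k \<in> G0" and a: "a \<in> c1" and s: "s \<in> c1" and x: "x \<in> line a"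
  shows "k (s + x) + k s \<in> line (k a)"
proof -
  have ka: "k a \<in> c1" using a c1_image[OF k] by simp
  have kin: "k y \<in> line (k a)" if "y \<in> line a" for y using that by (auto simp: line_image[OF k, symmetric])
  have subg: "add_subgroup (line (k a))" by (rule line_subgroup[OF ka])
  show ?thesis
  proof (cases "s \<in> line a")
    case True
    then have "s + x \<in> line a" using x line_subgroup[OF a] by (simp add: add_subgroup_def)
    then show ?thesis using kin[OF True] kin subg by (simp add: add_subgroup_def)
  next
    case False
    show ?thesis
    proof (cases "x = 0")
      case True then show ?thesis using subg by (simp add: add_self add_subgroup_def)
    next
      case False
      have "x \<in> c1" using x False by (simp add: line_def \<Lambda>_def)
      moreover have "s \<notin> line x" using \<open>s \<notin> line a\<close> line_eq[OF a x False] by simp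
      ultimately have "k (x + s) = k x + k s" using s by (intro additive_on_lines[OF k])
      then show ?thesis using kin[OF x] by (simp add: add.commute)
    qed
  qed
qed

text \<open>Induction along a path from 0 to \<open>v\<close> with steps in \<open>c1\<close>, which
  generates everything by primitivity. At each point \<open>line_shift_c1\<close> applies to the
  shifted map.\<close>

lemma line_cosets:
  assumes h: "h \<in> G0" and a: "a \<in> c1" and x: "x \<in> line a"
  shows "h (v + x) + h v \<in> line (h a)"
proof -
  have "additive_hull c1 = UNIV"
    using ax_c1 c1_image c1_ne_0 e0 ax_0 by (intro hull_UNIV[of c1 "ax e0"]) (auto dest: arg_cong[of _ _ "\<lambda>v. v $ i"] simp: ax_nth)
  then have "v \<in> additive_hull c1" by simp
  then show ?thesis using x
  proof (induction v arbitrary: x)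
    case zero
    then show ?case by (auto simp: G0_0[OF h] line_image[OF h, symmetric])
  next
    case (add v s)
    define k where "k = (\<lambda>x. h (v + x) + h v)"
    have k: "k \<in> G0" unfolding k_def by (rule shifted_G0[OF G0_sub[OF h]])
    have ka: "k a \<in> line (h a)" using add.IH[OF line_self[OF a]] by (simp add: k_def)
    have "h a \<in> c1" using a c1_image[OF h] by simp
    moreover have "k a \<noteq> 0" using a c1_ne_0 G0_eq_0[OF k] by auto
    \<comment> \<open>Shifting the base point does not change the target line, so the direction is
      the same for all cosets met on the path.\<close>
    ultimately have "line (k a) = line (h a)" using ka by (intro line_eq)
    moreover have "k (s + x) + k s \<in> line (k a)" using line_shift_c1[OF k a add.hyps(2) add.prems] .
    moreover have "k (s + x) + k s = h (v + s + x) + h (v + s)"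
      using cancel(2)[of "h (v + s + x) + h (v + s)" "h v"] by (simp add: k_def add_ac)
    ultimately show ?case by simp
  qed
qed

lemma transitive2_if_line_UNIV:
  assumes "line a = UNIV" "x \<noteq> y" "x' \<noteq> y'"
  shows "\<exists>g\<in>G. g x = x' \<and> g y = y'"
proof -
  have "\<Lambda> = UNIV" using assms(1) by (auto simp: line_def)
  then have all: "z \<in> c1" if "z \<noteq> 0" for z using that by (auto simp: \<Lambda>_def)
  then have "orb (x + y) = orb (x' + y')" using assms by (simp add: c1_iff)
  then obtain h where h: "h \<in> G0" "x' + y' = h (x + y)" by (metis orb_eq_iff orb_memD)
  have "transl x' \<circ> (h \<circ> transl x) \<in> G" using G h(1) G0_sub transl_G by (intro perm_groupD(4))
  moreover have "(transl x' \<circ> (h \<circ> transl x)) x = x'" by (simp add: transl_def add_self G0_0[OF h(1)])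
  moreover have "(transl x' \<circ> (h \<circ> transl x)) y = y'"
    using h(2)[symmetric] by (simp add: transl_def add.commute[of y x])
  ultimately show ?thesis by blast
qed

end

section \<open>From two-transitivity to the alternating group\<close>

context coordinate_group
begin

lemma card_F: "CARD('q) * card F = CARD('q^'n)" "card {w :: 'q^'n. w $ i \<in> A} = card A * card F"
proof -
  have "card {w :: 'q^'n. True} = (\<Sum>a\<in>(UNIV :: 'q set). card {f \<in> F. True})" by (rule card_slices)
  then show "CARD('q) * card F = CARD('q^'n)" by simp
  have "card {w :: 'q^'n. w $ i \<in> A} = (\<Sum>a\<in>UNIV. card {f \<in> F. (ax a + f) $ i \<in> A})" by (rule card_slices)
  also have "\<dots> = (\<Sum>a\<in>UNIV. if a \<in> A then card F else 0)"
  proof (rule sum.cong)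
    fix a
    have "{f \<in> F. (ax a + f) $ i \<in> A} = (if a \<in> A then F else {})" by (auto simp: F_def ax_nth)
    then show "card {f \<in> F. (ax a + f) $ i \<in> A} = (if a \<in> A then card F else 0)" by simp
  qed simp
  also have "\<dots> = card A * card F" by (simp add: sum.If_cases)
  finally show "card {w :: 'q^'n. w $ i \<in> A} = card A * card F" .
qed

lemma card_F_le: "8 * card F \<le> CARD('q^'n)"
  unfolding card_F(1)[symmetric] by (rule mult_right_mono[OF q8]) simp

text \<open>\<open>transitive3_of_transitive2\<close> is applied twice, to \<open>G\<close> on all
  points and then to \<open>G0\<close> on the nonzero points. The set \<open>M\<close> consists of
  two slices, at most a quarter of the space.\<close>

lemma transitive4_of_transitive2:
  assumes trans2: "\<And>x y x' y'. \<lbrakk>x \<noteq> y; x' \<noteq> y'\<rbrakk> \<Longrightarrow> \<exists>g\<in>G. g x = x' \<and> g y = y'"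
  shows "four_transitive G"
proof -
  have new: "\<exists>d :: 'q. d \<notin> A" if "card A < 8" for A using that q8 by (metis UNIV_eq_I leD)
  obtain b where b: "b \<notin> {0, e0}" using new[of "{0, e0}"] card_length[of "[0, e0]"] by auto
  define M where "M = {w :: 'q^'n. w $ i \<in> {e0, b}}"
  have "card M = 2 * card F" using card_F(2)[of "{e0, b}"] b by (auto simp: M_def)
  then have cardM: "4 * card M \<le> CARD('q^'n)" using card_F_le by simp
  have M: "ax e0 \<in> M" "ax b \<in> M" "ax e0 \<noteq> ax b" "0 \<notin> M"
    using b e0 by (auto simp: M_def ax_nth dest: arg_cong[of _ _ "\<lambda>v. v $ i"])
  have moves: "\<exists>h\<in>G0. h r = r \<and> h w = w \<and> h (ax e0) = ax b" if "r \<notin> M" "w \<notin> M" for r w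
  proof -
    \<comment> \<open>The third entry of the cycle must avoid the labels of 0, \<open>r\<close> and
      \<open>w\<close>; at most five labels are excluded.\<close>
    obtain d where d: "d \<notin> {0, e0, b, r $ i, w $ i}"
      using new[of "{0, e0, b, r $ i, w $ i}"] card_length[of "[0, e0, b, r $ i, w $ i]"] by auto
    let ?h = "lift i (cyc3 e0 b d)"
    have c: "cyc3 e0 b d x = (if x = e0 then b else if x = b then d else if x = d then e0 else x)" for x
      using b d by (intro cyc3_apply) auto
    have hG: "?h \<in> G" using b d by (intro lift_G cyc3_in_Alt) auto
    have fix_pt: "?h x = x" if "x $ i \<notin> {e0, b, d}" for x
      using that by (simp add: vec_eq_iff lift_nth c)
    have "?h 0 = 0" using b d e0 by (intro fix_pt) auto
    moreover have "?h r = r" "?h w = w" using d that by (auto intro!: fix_pt simp: M_def)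
    moreover have "?h (ax e0) = ax b" by (simp add: vec_eq_iff lift_nth c axis_def)
    ultimately show ?thesis using hG by (intro bexI[of _ ?h]) (auto simp: G0_def)
  qed
  have trans3: "\<exists>g\<in>G. g x = x' \<and> g y = y' \<and> g z = z'"
    if "x \<noteq> y" "x \<noteq> z" "y \<noteq> z" "x' \<noteq> y'" "x' \<noteq> z'" "y' \<noteq> z'" for x y z x' y' z'
  proof (rule transitive3_of_transitive2[OF G, where R = UNIV and M = M and u = "ax e0" and v = "ax b"])
    fix r w assume "r \<in> UNIV - M" "w \<in> UNIV - M"
    then show "\<exists>h\<in>G. h r = r \<and> h w = w \<and> h (ax e0) = ax b" using moves[of r w] G0_sub by blast
  qed (use M cardM trans2 that in auto)
  have trans3': "\<exists>h\<in>G0. h x = x' \<and> h y = y' \<and> h z = z'"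
    if "x \<noteq> y" "x \<noteq> z" "y \<noteq> z" "x' \<noteq> y'" "x' \<noteq> z'" "y' \<noteq> z'" "0 \<notin> {x, y, z, x', y', z'}" for x y z x' y' z'
  proof (rule transitive3_of_transitive2[OF G0_group, where R = "UNIV - {0}" and M = M and u = "ax e0" and v = "ax b"])
    fix r w assume "r \<in> UNIV - {0} - M" "w \<in> UNIV - {0} - M"
    then show "\<exists>h\<in>G0. h r = r \<and> h w = w \<and> h (ax e0) = ax b" using moves[of r w] by blast
  next
    fix x y x' y' :: "'q^'n" assume "x \<in> UNIV - {0}" "y \<in> UNIV - {0}" "x \<noteq> y" "x' \<in> UNIV - {0}" "y' \<in> UNIV - {0}" "x' \<noteq> y'"
    then show "\<exists>h\<in>G0. h x = x' \<and> h y = y'" using trans3[of x y 0 x' y' 0] by (auto simp: G0_def)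
  next
    show "4 * card M \<le> card (UNIV - {0 :: 'q^'n}) + 5" using cardM by (simp add: card_Diff_subset)
  next
    fix h and x :: "'q^'n" assume "h \<in> G0" "x \<in> UNIV - {0}"
    then show "h x \<in> UNIV - {0}" using G0_eq_0[of h x] by simp
  qed (use M that in auto)
  show ?thesis
  proof
    fix a b c d a' b' c' d' :: "'q^'n"
    assume d: "distinct [a, b, c, d]" "distinct [a', b', c', d']"
    obtain h where h: "h \<in> G0" "h (a + b) = a' + b'" "h (a + c) = a' + c'" "h (a + d) = a' + d'"
      using trans3'[of "a + b" "a + c" "a + d" "a' + b'" "a' + c'" "a' + d'"] d by auto
    have "transl a' \<circ> (h \<circ> transl a) \<in> G" using G h(1) G0_sub transl_G by (intro perm_groupD(4))
    moreover have "(transl a' \<circ> (h \<circ> transl a)) a = a'" by (simp add: transl_def add_self G0_0[OF h(1)])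
    moreover have "(transl a' \<circ> (h \<circ> transl a)) b = b'" "(transl a' \<circ> (h \<circ> transl a)) c = c'"
      "(transl a' \<circ> (h \<circ> transl a)) d = d'"
      using h(2-4) by (simp_all add: transl_def add.commute[of _ a])
    ultimately show "\<exists>g\<in>G. g a = a' \<and> g b = b' \<and> g c = c' \<and> g d = d'" by blast
  next
    have "CARD('q) \<le> CARD('q) ^ CARD('n)" using q8 by (intro self_le_power) auto
    then show "4 \<le> CARD('q^'n)" using q8 by simp
  qed (rule G)
qed

text \<open>A three-cycle on one coordinate moves three slices, at most three eighths of the space,
  which starts the descent; two coordinates give at least 64 points.\<close>

lemma Alt_subset_of_transitive2:
  assumes trans2: "\<And>x y x' y'. \<lbrakk>x \<noteq> y; x' \<noteq> y'\<rbrakk> \<Longrightarrow> \<exists>g\<in>G. g x = x' \<and> g y = y'"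
    and "G \<subseteq> Alt" "2 \<le> CARD('n)"
  shows "Alt \<subseteq> G"
proof -
  interpret four_transitive G by (rule transitive4_of_transitive2[OF trans2])
  have new: "\<exists>d :: 'q. d \<notin> A" if "card A < 8" for A using that q8 by (metis UNIV_eq_I leD)
  obtain b where b: "b \<notin> {0, e0}" using new[of "{0, e0}"] card_length[of "[0, e0]"] by auto
  let ?x = "lift i (cyc3 0 e0 b)"
  have c: "cyc3 0 e0 b x = (if x = 0 then e0 else if x = e0 then b else if x = b then 0 else x)" for x
    using b e0 by (intro cyc3_apply) auto
  have "{z. ?x z \<noteq> z} \<subseteq> {w. w $ i \<in> {0, e0, b}}"
    by (auto simp: vec_eq_iff lift_nth c split: if_splits)
  then have "card {z. ?x z \<noteq> z} \<le> card {w :: 'q^'n. w $ i \<in> {0, e0, b}}" by (intro card_mono) auto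
  also have "\<dots> = card {0, e0, b} * card F" by (rule card_F(2))
  also have "card {0, e0, b} = 3" using b e0 by auto
  finally have deg: "8 * card {z. ?x z \<noteq> z} \<le> 3 * CARD('q^'n)" using card_F_le by linarith
  have "?x 0 $ i \<noteq> 0" using e0 by (simp add: lift_nth c)
  then have "?x \<noteq> id" by auto
  moreover have "?x \<in> G" using b e0 by (intro lift_G cyc3_in_Alt) auto
  moreover have "64 \<le> CARD('q^'n)"
  proof -
    have "(8::nat) ^ 2 \<le> CARD('q) ^ 2" using q8 by (intro power_mono) auto
    also have "\<dots> \<le> CARD('q) ^ CARD('n)" using q8 assms(3) by (intro power_increasing) auto
    finally show ?thesis by simp
  qed
  ultimately show ?thesis using Alt_subset[OF assms(2)] deg by blast
qed

end

section \<open>The group of the round functions\<close>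

lemma gen_perm_group:
  assumes "\<And>f. f \<in> S \<Longrightarrow> bij f"
  shows "perm_group (gen_perm S)"
proof -
  have comp: "f \<circ> g \<in> gen_perm S" if "g \<in> gen_perm S" "f \<in> gen_perm S" for f g
    using that by induction (simp_all add: comp_assoc[symmetric] gen_perm.intros)
  have S: "f \<in> gen_perm S" "inv f \<in> gen_perm S" if "f \<in> S" for f
    using gen_perm.gen_mult[OF that gen_perm.gen_id] gen_perm.gen_inv[OF that gen_perm.gen_id] by simp_all
  have "bij f \<and> inv f \<in> gen_perm S" if "f \<in> gen_perm S" for f
    using that
  proof induction
    case gen_id then show ?case by (simp only: bij_id inv_id gen_perm.gen_id simp_thms)
  next
    case (gen_mult f g)
    then have f: "bij f" "bij g" "inv g \<in> gen_perm S" "inv f \<in> gen_perm S" using assms S by auto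
    have "inv (g \<circ> f) = inv f \<circ> inv g" by (rule o_inv_distrib[OF f(2,1)])
    then show ?case using bij_comp[OF f(1,2)] comp[OF f(3,4)] by metis
  next
    case (gen_inv f g)
    then have f: "bij (inv f)" "bij g" "inv g \<in> gen_perm S" "inv (inv f) \<in> gen_perm S"
      using assms[of f] S by (auto simp: bij_imp_bij_inv inv_inv_eq)
    have "inv (g \<circ> inv f) = inv (inv f) \<circ> inv g" by (rule o_inv_distrib[OF f(2,1)])
    then show ?case using bij_comp[OF f(1,2)] comp[OF f(3,4)] by metis
  qed
  then show ?thesis using comp by (auto simp: perm_group_def gen_perm.gen_id)
qed

lemma gen_perm_incl: "f \<in> S \<Longrightarrow> f \<in> gen_perm S"
  using gen_perm.gen_mult[OF _ gen_perm.gen_id] by simp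

lemma gen_perm_subset:
  assumes "perm_group G" "S \<subseteq> G"
  shows "gen_perm S \<subseteq> G"
proof
  fix f assume "f \<in> gen_perm S"
  then show "f \<in> G" by induction (use assms perm_groupD in blast)+
qed

lemma Alt_group: "perm_group (Alt :: ('a::finite \<Rightarrow> 'a) set)"
proof -
  have "p permutes UNIV \<longleftrightarrow> bij p" for p :: "'a \<Rightarrow> 'a"
    using permutes_bij bij_imp_permutes[of p UNIV] by auto
  then show ?thesis
    by (auto simp: perm_group_def Alt_def bij_comp bij_imp_bij_inv evenperm_comp evenperm_inv permutation_of_bij)
qed

lemma transl_bij: "bij (transl v)"
  by (rule o_bij[of "transl (- v)"]) (auto simp: fun_eq_iff transl_def)

lemma transl_eq_bricklayer: "transl v = bricklayer (\<lambda>j. transl (v $ j))"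
  by (auto simp: fun_eq_iff vec_eq_iff transl_def bricklayer_nth)

text \<open>Translation by a unit vector flips one bit and serves as the swap in
  \<open>even_bricklayer\<close>.\<close>

lemma even_bit_bricklayer:
  fixes b :: "'n::finite \<Rightarrow> bit^'m::finite \<Rightarrow> bit^'m"
  assumes "bricks_ok b" "2 \<le> CARD('n)"
  shows "evenperm (bricklayer b)"
proof -
  obtain k :: 'm where True by blast
  show ?thesis
  proof (rule even_bricklayer[OF assms transl_bij])
    fix x :: "bit^'m"
    show "(transl (axis k 1) x $ k = 0) = (\<not> x $ k = 0)" by (cases "x $ k") (auto simp: transl_def axis_def)
  qed
qed

lemma round_fun_even:
  fixes bs :: "nat \<Rightarrow> 'n::finite \<Rightarrow> bit^'m::finite \<Rightarrow> bit^'m"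
  assumes "bricks_ok (bs h)" "lam h \<in> GL2" "CARD('m) \<ge> 3" "CARD('n) \<ge> 2"
  shows "round_fun bs lam phi k h \<in> Alt"
proof -
  have b: "bij (bricklayer (bs h))" "evenperm (bricklayer (bs h))"
    using assms bricklayer_bij even_bit_bricklayer by blast+
  have t: "evenperm (transl (phi k h))"
    by (subst transl_eq_bricklayer, rule even_bit_bricklayer) (use assms in \<open>auto simp: bricks_ok_def transl_bij\<close>)
  have "8 \<le> CARD((bit^'m)^'n)"
  proof -
    have "(2::nat) ^ 3 \<le> 2 ^ CARD('m)" using assms by (intro power_increasing) auto
    also have "\<dots> \<le> (2 ^ CARD('m)) ^ CARD('n)" using assms by (intro self_le_power) auto
    finally show ?thesis by (simp only: CARD_vec[where 'b = 'n] card_bit_vec) simp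
  qed
  then have l: "evenperm (lam h)" "bij (lam h)" using bvv.even_GL2 assms(2) by (auto simp: GL2_def)
  have "bij (round_fun bs lam phi k h)" using b l transl_bij by (auto simp: round_fun_def intro!: bij_comp)
  moreover have "evenperm (round_fun bs lam phi k h)"
  proof -
    have tl: "bij (transl (phi k h) \<circ> lam h)" using l(2) transl_bij by (rule bij_comp)
    have "evenperm (transl (phi k h) \<circ> lam h) = (evenperm (transl (phi k h)) = evenperm (lam h))"
      using transl_bij l(2) by (intro evenperm_comp permutation_of_bij)
    moreover have "evenperm (transl (phi k h) \<circ> lam h \<circ> bricklayer (bs h))
        = (evenperm (transl (phi k h) \<circ> lam h) = evenperm (bricklayer (bs h)))"
      using tl b(1) by (intro evenperm_comp permutation_of_bij)
    ultimately show ?thesis unfolding round_fun_def using b(2) l(1) t by blast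
  qed
  ultimately show ?thesis by (auto simp: Alt_def intro: bij_imp_permutes)
qed

theorem theorem4p7:
  fixes l :: nat
    and bs :: "nat \<Rightarrow> 'n::finite \<Rightarrow> bit^'m::finite \<Rightarrow> bit^'m"
    and lam :: "nat \<Rightarrow> (bit^'m)^'n \<Rightarrow> (bit^'m)^'n"
    and phi :: "'k \<Rightarrow> nat \<Rightarrow> (bit^'m)^'n"
    and h :: nat and r :: nat and i :: 'n
  assumes "CARD('m) \<ge> 3" and "CARD('n) \<ge> 2"
    and "tb_cipher l bs lam phi"
    and "h \<in> {1..l}" and "strongly_proper_round lam phi h"
    and "(1 < r \<and> r < CARD('m) \<and>
            (\<forall>j. diff_uniform (2 ^ r) (bs h j) \<and> strongly_anti_invariant (r - 1) (bs h j)))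
       \<or> (1 \<le> r \<and> r < CARD('m) \<and>
            (\<forall>j. weakly_uniform (2 ^ r) (bs h j) \<and> strongly_anti_invariant r (bs h j)))"
    and "Alt \<subseteq> gen_perm (Tgrp \<union> {inv (bs h i) \<circ> t \<circ> bs h i | t. t \<in> Tgrp})"
  shows "Gamma_inf l bs lam phi = Alt"
proof -
  let ?G = "Gamma_inf l bs lam phi"
  let ?\<gamma> = "bricklayer (bs h)" and ?L = "lam h"
  define \<rho> where "\<rho> = ?L \<circ> ?\<gamma>"
  have cipher: "bricks_ok (bs j)" "lam j \<in> GL2" if "j \<in> {1..l}" for j
    using assms(3) that by (auto simp: tb_cipher_def)
  have gens: "{round_fun bs lam phi k j |k j. j \<in> {1..l}} \<subseteq> Alt"
  proof clarify
    fix k j assume "j \<in> {1..l}"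
    then show "round_fun bs lam phi k j \<in> Alt" using cipher assms(1,2) by (intro round_fun_even)
  qed
  have even: "?G \<subseteq> Alt" unfolding Gamma_inf_def by (rule gen_perm_subset[OF Alt_group gens])
  have G: "perm_group ?G" unfolding Gamma_inf_def
    by (rule gen_perm_group, rule perm_groupD(2)[OF Alt_group]) (use gens in auto)
  have round_G: "round_fun bs lam phi k h \<in> ?G" for k
    unfolding Gamma_inf_def using assms(4) by (intro gen_perm_incl) blast
  have strong: "?L ` W \<noteq> W'" if "W \<in> walls" "W' \<in> walls" for W W'
    using assms(5) that unfolding strongly_proper_round_def strongly_proper_mixing_def by blast
  have key: "\<exists>k. phi k h = v" for v
    using assms(5) unfolding strongly_proper_round_def surj_def by metis
  have bij_b: "bij (bs h j)" for j using cipher(1)[OF assms(4)] by (simp add: bricks_ok_def)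
  have \<gamma>_0: "?\<gamma> 0 = 0" using assms(3,4) by (simp add: tb_cipher_def)
  have b0: "bs h j 0 = 0" for j
  proof -
    from \<gamma>_0 have "?\<gamma> 0 $ j = 0" by simp
    then show ?thesis by (simp add: bricklayer_nth)
  qed
  have bij_\<gamma>: "bij ?\<gamma>" by (rule bricklayer_bij[OF cipher(1)[OF assms(4)]])
  have lam: "bij ?L" "\<And>x y. ?L (x + y) = ?L x + ?L y" using cipher(2)[OF assms(4)] by (auto simp: GL2_def)
  have lam_0: "?L 0 = 0" using lam(2)[of 0 0] bvv.add_self[of "?L 0"] by simp
  have \<rho>_G: "\<rho> \<in> ?G"
  proof -
    obtain k where "phi k h = 0" using key by blast
    then have "round_fun bs lam phi k h = \<rho>" by (simp add: round_fun_def \<rho>_def fun_eq_iff transl_def)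
    then show ?thesis using round_G[of k] by simp
  qed
  have bij_\<rho>: "bij \<rho>" using bij_\<gamma> lam(1) by (simp add: \<rho>_def bij_comp)
  \<comment> \<open>Dividing a round function by \<open>\<rho>\<close> leaves the key
    addition.\<close>
  have transl_G: "transl v \<in> ?G" for v
  proof -
    obtain k where "phi k h = v" using key by blast
    then have "round_fun bs lam phi k h \<circ> inv \<rho> = transl v"
      using bij_\<rho> by (simp add: round_fun_def \<rho>_def[symmetric] comp_assoc bij_is_surj surj_iff[THEN iffD1])
    then show ?thesis using perm_groupD(3,4)[OF G] round_G \<rho>_G by metis
  qed
  have lift_G: "lift i g \<in> ?G" if "g \<in> Alt" for g
  proof -
    have transl_lift: "lift i (transl e) \<in> ?G" for e
    proof -
      have "lift i (transl e) = transl (axis i e)" by (auto simp: fun_eq_iff vec_eq_iff lift_nth transl_def axis_def)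
      then show ?thesis using transl_G by simp
    qed
    have conj_lift: "lift i (inv (bs h i) \<circ> transl e \<circ> bs h i) \<in> ?G" for e
    proof -
      \<comment> \<open>Conjugation by \<open>\<rho>\<close> undoes \<open>?L\<close> on the
        translation vector and leaves the translation by \<open>e\<close> conjugated by the
        \<open>i\<close>-th brick alone.\<close>
      have "lift i (inv (bs h i) \<circ> transl e \<circ> bs h i) = inv \<rho> \<circ> transl (?L (axis i e)) \<circ> \<rho>"
      proof
        fix v
        have "?\<gamma> (lift i (inv (bs h i) \<circ> transl e \<circ> bs h i) v) = ?\<gamma> v + axis i e"
          using bij_b by (auto simp: vec_eq_iff bricklayer_nth lift_nth transl_def axis_def bij_is_surj surj_f_inv_f)
        then have "\<rho> (lift i (inv (bs h i) \<circ> transl e \<circ> bs h i) v) = transl (?L (axis i e)) (\<rho> v)"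
          by (simp add: \<rho>_def lam(2) transl_def)
        then show "lift i (inv (bs h i) \<circ> transl e \<circ> bs h i) v = (inv \<rho> \<circ> transl (?L (axis i e)) \<circ> \<rho>) v"
          using bij_\<rho> by (metis bij_is_inj comp_apply inv_f_f)
      qed
      then show ?thesis using perm_groupD(3,4)[OF G] \<rho>_G transl_G by simp
    qed
    let ?S = "Tgrp \<union> {inv (bs h i) \<circ> t \<circ> bs h i | t. t \<in> Tgrp}"
    have S: "lift i f \<in> ?G \<and> bij f" if "f \<in> ?S" for f
      using that transl_lift conj_lift bij_b[of i] transl_bij
      by (auto simp: Tgrp_def bij_comp bij_imp_bij_inv)
    have "g \<in> gen_perm ?S" using that assms(7) by blast
    then show ?thesis
    proof induction
      case gen_id then show ?case unfolding lift_id by (rule perm_groupD(1)[OF G])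
    next
      case (gen_mult f g)
      then have "lift i g \<circ> lift i f \<in> ?G" using S perm_groupD(4)[OF G] by blast
      then show ?case by (simp only: lift_comp)
    next
      case (gen_inv f g)
      then have "lift i g \<circ> inv (lift i f) \<in> ?G" using S perm_groupD(3,4)[OF G] by blast
      then show ?case using S[OF gen_inv.hyps(1)] by (simp only: lift_comp lift_inv)
    qed
  qed
  have good: "good_brick r (bs h j)" for j using assms(6) by (auto simp: good_brick_def)
  have wall: "\<exists>I. U = wall_of I \<and> ?L ` U = W"
    if UW: "add_subgroup U" "add_subgroup W" "\<rho> ` U = W" "\<And>u v. u \<in> U \<Longrightarrow> \<rho> (v + u) + \<rho> v \<in> W" for U W
  proof -
    \<comment> \<open>Splitting off the linear factor reduces the claim to \<open>?\<gamma>\<close>: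
      it maps \<open>U\<close> to \<open>W'\<close>, so \<open>W' = U\<close> is a wall or trivial,
      and \<open>?L\<close> maps it to \<open>W\<close>.\<close>
    define W' where "W' = ?L -` W"
    have "add_subgroup W'" using UW(2) lam(2) lam_0 by (simp add: add_subgroup_def W'_def)
    moreover have "?\<gamma> ` U = W'"
    proof -
      have "W' = ?L -` (?L ` (?\<gamma> ` U))" using UW(3) by (auto simp: W'_def \<rho>_def image_comp)
      then show ?thesis using lam(1) by (simp add: bij_is_inj inj_vimage_image_eq)
    qed
    moreover have "?\<gamma> (v + u) + ?\<gamma> v \<in> W'" if "u \<in> U" for u v
      using UW(4)[OF that, of v] by (simp add: W'_def \<rho>_def lam(2))
    ultimately obtain I where I: "U = wall_of I" "W' = U"
      using coset_mapped_subgroup_is_wall[of r "bs h" U W', OF good bij_b b0 UW(1)] by blast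
    have "?L ` W' = W" using lam(1) by (simp add: W'_def bij_is_surj surj_image_vimage_eq)
    then show ?thesis using I by auto
  qed
  have wall_in: "U \<in> walls" if "U = wall_of I" "U \<noteq> {0}" "U \<noteq> UNIV" for I and U :: "((bit^'m)^'n) set"
  proof -
    have "I \<noteq> {}" using that(1,2) by (auto simp: wall_of_def vec_eq_iff)
    moreover have "I \<noteq> UNIV" using that(1,3) by (auto simp: wall_of_def)
    ultimately show ?thesis using that(1) by (auto simp: walls_def)
  qed
  interpret coordinate_group ?G i
  proof
    show "perm_group ?G" by (rule G)
    show "transl v \<in> ?G" for v by (rule transl_G)
    show "lift i g \<in> ?G" if "g \<in> Alt" for g using that by (rule lift_G)
    show "U = {0} \<or> U = UNIV" if U: "add_subgroup U" "\<And>g u v. g \<in> ?G \<Longrightarrow> u \<in> U \<Longrightarrow> g (v + u) + g v \<in> U" for U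
    proof (rule ccontr)
      assume nt: "\<not> (U = {0} \<or> U = UNIV)"
      have "\<rho> u \<in> U" if "u \<in> U" for u
        using U(2)[OF \<rho>_G that, of 0] by (simp add: \<rho>_def \<gamma>_0 lam_0)
      then have "\<rho> ` U \<subseteq> U" by blast
      moreover have "card (\<rho> ` U) = card U" using bij_\<rho> by (meson bij_is_inj card_image inj_on_subset subset_UNIV)
      ultimately have "\<rho> ` U = U" by (intro card_subset_eq) auto
      \<comment> \<open>A nontrivial proper \<open>U\<close> would be a wall invariant under
        \<open>?L\<close>, which strong properness excludes in the special case of equal
        walls.\<close>
      then obtain I where "U = wall_of I" "?L ` U = U" using wall[OF U(1) U(1)] U(2)[OF \<rho>_G] by blast
      then show False using strong wall_in nt by metis
    qed
    have "(2::nat) ^ 3 \<le> 2 ^ CARD('m)" using assms(1) by (intro power_increasing) auto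
    then show "8 \<le> CARD(bit^'m)" by (simp only: card_bit_vec) simp
  qed
  have \<rho>0: "\<rho> \<in> G0" using \<rho>_G by (simp add: G0_def \<rho>_def \<gamma>_0 lam_0)
  \<comment> \<open>\<open>line_cosets\<close> is exactly the coset condition of
    \<open>wall\<close>, for the lines of \<open>a\<close> and of \<open>\<rho> a\<close>.\<close>
  have line_wall: "\<exists>I. line a = wall_of I \<and> ?L ` line a = line (\<rho> a)" if a: "a \<in> c1" for a
    using a \<rho>0 c1_image line_subgroup line_image line_cosets by (intro wall) auto
  have "line (ax e0) = UNIV"
  proof (rule ccontr)
    assume ne: "line (ax e0) \<noteq> UNIV"
    have c: "\<rho> (ax e0) \<in> c1" using ax_c1 c1_image[OF \<rho>0] by simp
    have "card (line (\<rho> (ax e0))) = card (line (ax e0))" by (rule card_line_image[OF \<rho>0])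
    then have ne': "line (\<rho> (ax e0)) \<noteq> UNIV" using ne card_subset_eq[OF finite subset_UNIV] by metis
    have nz: "line a \<noteq> {0}" if "a \<in> c1" for a
    proof
      assume "line a = {0}"
      then have "a = 0" using line_self[OF that] by blast
      then show False using that c1_ne_0 by simp
    qed
    obtain I I' where I: "line (ax e0) = wall_of I" "line (\<rho> (ax e0)) = wall_of I'"
      and img: "?L ` line (ax e0) = line (\<rho> (ax e0))"
      using line_wall[OF ax_c1] line_wall[OF c] by blast
    \<comment> \<open>Here the two walls may differ, so the full strength of strong properness is
      used.\<close>
    have "line (ax e0) \<in> walls" "line (\<rho> (ax e0)) \<in> walls"
      by (rule wall_in[OF I(1) nz[OF ax_c1] ne], rule wall_in[OF I(2) nz[OF c] ne'])
    then show False using strong img by blast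
  qed
  then have "Alt \<subseteq> ?G"
    using transitive2_if_line_UNIV even assms(2) by (intro Alt_subset_of_transitive2) auto
  then show ?thesis using even by blast
qed

end
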